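(* Let $K$ be a number field of degree $d$. Then the set $\mathbf{BA}_K\subseteq K_S$ of badly approximable $S$-numbers is $\mathcal{H}_K$-absolute winning (for the $\mathcal{H}_K$-absolute game played on $Y=X=K_S$), where $$\mathcal{H}_K=\Big\{\mathcal{L}(\mathbf{x},T):\ \mathbf{x}\in\iota_S(K),\ T\subseteq S \text{ with } \#T_{\mathbb{R}}+2\,\#T_{\mathbb{C}}>\tfrac d2\Big\}.$$
   Context: Number field notation. $K$ is a number field of degree $d$ with ring of integers $\mathcal{O}$; $S$ is the set of Archimedean places of $K$ (one for each real embedding and one for each conjugate pair of complex embeddings). For $v\in S$, $K_v\cong\mathbb{R}$ or $\mathbb{C}$ is the completion with its usual absolute value $|\cdot|$, and $\iota_v:K\to K_v$ is the embedding. $K_S=\prod_{v\in S}K_v\cong\mathbb{R}^d$, with coordinatewise multiplication $\mathbf{x}\cdot\mathbf{y}=(x_vy_v)_{v\in S}$ and norm $\|\mathbf{x}\|=\max_{v\in S}|x_v|$ (which gives the metric), and $\iota_S:K\to K_S$, $r\mapsto(\iota_v(r))_{v\in S}$. An element $\mathbf{x}\in K_S$ is badly approximable if there is $c>0$ such that $\|\iota_S(q)\cdot\mathbf{x}+\iota_S(p)\|>c\,\|\iota_S(q)\|^{-1}$ for all $p\in\mathcal{O}$, $q\in\mathcal{O}\smallsetminus\{0\}$; $\mathbf{BA}_K$ is the set of all such $\mathbf{x}$. For $T\subseteq S$, $T_{\mathbb{R}}=\{v\in T:K_v\cong\mathbb{R}\}$, $T_{\mathbb{C}}=\{v\in T:K_v\cong\mathbb{C}\}$,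 and for $\mathbf{x}\in K_S$, $\mathcal{L}(\mathbf{x},T)=\{\mathbf{y}\in K_S:\ y_v=x_v\ \forall v\in T\}$. The $\mathcal{H}$-absolute game. Let $(X,\mathrm{dist})$ be a complete metric space, $\mathcal{H}$ a non-empty collection of closed subsets of $X$, $Y\subseteq X$ non-empty closed, $0<\beta<1$. A formal ball is a pair $B=(x,\rho)\in X\times\mathbb{R}_{>0}$, with associated closed ball $\mathbf{B}(B)=\mathbf{B}(x,\rho)=\{y\in X:\mathrm{dist}(x,y)\le\rho\}$; write $(x_1,\rho_1)\preceq(x_2,\rho_2)$ iff $\mathrm{dist}(x_1,x_2)\le\rho_2-\rho_1$. In the $(\mathcal{H},\beta)$-absolute game on $Y$, Bob and Alice alternately choose $B_1,A_1,B_2,A_2,\dots$ such that: Bob chooses $B_n=(c_n,r_n)\in Y\times\mathbb{R}_{>0}$; Alice chooses $A_n=(\mathcal{L}_n,\rho_n)\in\mathcal{H}\times\mathbb{R}_{>0}$ with $0<\rho_n\le\beta r_n$; $\beta r_n\le r_{n+1}\le r_n$ and $B_{n+1}\preceq B_n$; and $\mathrm{dist}(c_{n+1},\mathcal{L}_n)>\rho_n+r_{n+1}$. If at some stage Bob has no legal choice of $B_{n+1}$, the game ends and Bob wins. A set $W\subseteq X$ is $(\mathcal{H},\beta)$-absolute winning on $Y$ if Alice has a strategy ensuring that Bob always has a legal move and that $W\cap Y\cap\bigcap_{n\ge1}\mathbf{B}(B_n)\ne\varnothing$ regardless of Bob's play. $W$ is $\mathcal{H}$-absolute winning on $Y$ if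 there is $\beta_0>0$ such that $W$ is $(\mathcal{H},\beta)$-absolute winning on $Y$ for all $0<\beta<\beta_0$. "On $Y$" is omitted when $Y=X$. *)

theory Defs
  imports "HOL-Analysis.Analysis" "HOL-Computational_Algebra.Polynomial"
begin

section \<open>The \<open>H\<close>-absolute game\<close>

text \<open>
  A formal ball is a pair of a centre and a (positive) radius; a move of Alice is a pair of a
  member of \<open>H\<close> and a radius. The moves \<open>B\<^sub>1, A\<^sub>1, B\<^sub>2, A\<^sub>2, \<dots>\<close> are numbered from \<open>0\<close> here.
\<close>

type_synonym 'a formal_ball = "'a \<times> real"
type_synonym 'a alice_move = "'a set \<times> real"

definition ball_of :: "'a::metric_space formal_ball \<Rightarrow> 'a set" where
  "ball_of B = cball (fst B) (snd B)"

definition formal_le :: "'a::metric_space formal_ball \<Rightarrow> 'a formal_ball \<Rightarrow> bool"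
    (infix \<open>\<preceq>\<close> 50) where
  "B \<preceq> B' \<longleftrightarrow> dist (fst B) (fst B') \<le> snd B' - snd B"

definition bob_first :: "'a set \<Rightarrow> 'a formal_ball \<Rightarrow> bool" where
  "bob_first Y B \<longleftrightarrow> fst B \<in> Y \<and> snd B > 0"

definition alice_legal :: "'a set set \<Rightarrow> real \<Rightarrow> 'a formal_ball \<Rightarrow> 'a alice_move \<Rightarrow> bool" where
  "alice_legal H \<beta> B A \<longleftrightarrow> fst A \<in> H \<and> 0 < snd A \<and> snd A \<le> \<beta> * snd B"

text \<open>
  \<open>infdist c L\<close> is the distance from a point to a set. It is \<open>0\<close> rather than infinite if
  \<open>L\<close> is empty, so the following is meant for collections \<open>H\<close> of nonempty closed sets; see
  \<open>H_K_closed_nonempty\<close> below.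
\<close>

definition bob_next ::
  "'a::metric_space set \<Rightarrow> real \<Rightarrow> 'a formal_ball \<Rightarrow> 'a alice_move \<Rightarrow> 'a formal_ball \<Rightarrow> bool" where
  "bob_next Y \<beta> B A B' \<longleftrightarrow>
     fst B' \<in> Y \<and> snd B' > 0 \<and> \<beta> * snd B \<le> snd B' \<and> snd B' \<le> snd B \<and> B' \<preceq> B \<and>
     infdist (fst B') (fst A) > snd A + snd B'"

text \<open>
  A strategy of Alice maps the list of all moves made by Bob so far to her next move; her own
  earlier moves are determined by the strategy and that list.
\<close>

type_synonym 'a strategy = "'a formal_ball list \<Rightarrow> 'a alice_move"

definition alice_reply :: "'a strategy \<Rightarrow> (nat \<Rightarrow> 'a formal_ball) \<Rightarrow> nat \<Rightarrow> 'a alice_move" where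
  "alice_reply s B n = s (map B [0..<Suc n])"

text \<open>The first \<open>n + 1\<close> moves of Bob are legal when Alice follows the strategy \<open>s\<close>.\<close>

definition bob_legal_upto ::
  "'a::metric_space set \<Rightarrow> real \<Rightarrow> 'a strategy \<Rightarrow> (nat \<Rightarrow> 'a formal_ball) \<Rightarrow> nat \<Rightarrow> bool" where
  "bob_legal_upto Y \<beta> s B n \<longleftrightarrow>
     bob_first Y (B 0) \<and> (\<forall>i<n. bob_next Y \<beta> (B i) (alice_reply s B i) (B (Suc i)))"

definition winning_strategy ::
  "'a::complete_space set set \<Rightarrow> real \<Rightarrow> 'a set \<Rightarrow> 'a set \<Rightarrow> 'a strategy \<Rightarrow> bool" where
  "winning_strategy H \<beta> Y W s \<longleftrightarrow>
     (\<forall>B. (\<forall>n. bob_legal_upto Y \<beta> s B n \<longrightarrow>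
                alice_legal H \<beta> (B n) (alice_reply s B n) \<and>
                (\<exists>B'. bob_next Y \<beta> (B n) (alice_reply s B n) B')) \<and>
          ((\<forall>n. bob_legal_upto Y \<beta> s B n) \<longrightarrow> W \<inter> Y \<inter> (\<Inter>n. ball_of (B n)) \<noteq> {}))"

definition beta_absolute_winning_on ::
  "'a::complete_space set set \<Rightarrow> real \<Rightarrow> 'a set \<Rightarrow> 'a set \<Rightarrow> bool" where
  "beta_absolute_winning_on H \<beta> Y W \<longleftrightarrow> (\<exists>s. winning_strategy H \<beta> Y W s)"

text \<open>The game is only considered for \<open>0 < \<beta> < 1\<close>, whence the bound on \<open>\<beta>\<^sub>0\<close>.\<close>

definition absolute_winning_on ::
  "'a::complete_space set set \<Rightarrow> 'a set \<Rightarrow> 'a set \<Rightarrow> bool" where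
  "absolute_winning_on H Y W \<longleftrightarrow>
     (\<exists>\<beta>\<^sub>0. 0 < \<beta>\<^sub>0 \<and> \<beta>\<^sub>0 \<le> 1 \<and>
        (\<forall>\<beta>. 0 < \<beta> \<and> \<beta> < \<beta>\<^sub>0 \<longrightarrow> beta_absolute_winning_on H \<beta> Y W))"

abbreviation absolute_winning :: "'a::complete_space set set \<Rightarrow> 'a set \<Rightarrow> bool" where
  "absolute_winning H W \<equiv> absolute_winning_on H UNIV W"


section \<open>Number fields and their Archimedean places\<close>

global_interpretation rat_space: vector_space "\<lambda>(q::rat) (x::'k::field_char_0). of_rat q * x"
  by unfold_locales (simp_all add: algebra_simps of_rat_add of_rat_mult)

text \<open>
  A number field is a field of characteristic \<open>0\<close> with a finite spanning set over the rationals.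
  The rational coefficients are written as quotients of integers because \<^const>\<open>of_rat\<close> cannot
  be used in a class specification; see \<open>finite_rational_span_iff\<close> below.
\<close>

class number_field = field_char_0 +
  assumes finite_rational_span:
    "\<exists>B. finite B \<and> (\<forall>x. \<exists>m n :: 'a \<Rightarrow> int. (\<forall>b\<in>B. n b \<noteq> 0) \<and>
       x = (\<Sum>b\<in>B. of_int (m b) / of_int (n b) * b))"

lemma finite_rational_span_iff:
  "(\<exists>B :: 'a::field_char_0 set. finite B \<and> (\<forall>x. \<exists>m n :: 'a \<Rightarrow> int. (\<forall>b\<in>B. n b \<noteq> 0) \<and>
       x = (\<Sum>b\<in>B. of_int (m b) / of_int (n b) * b)))
   \<longleftrightarrow> (\<exists>B :: 'a set. finite B \<and> rat_space.span B = UNIV)"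
proof -
  have "(\<exists>m n :: 'a \<Rightarrow> int. (\<forall>b\<in>B. n b \<noteq> 0) \<and> x = (\<Sum>b\<in>B. of_int (m b) / of_int (n b) * b))
     \<longleftrightarrow> (\<exists>c :: 'a \<Rightarrow> rat. x = (\<Sum>b\<in>B. of_rat (c b) * b))" (is "?L \<longleftrightarrow> ?R") for B and x :: 'a
  proof
    assume ?L
    then obtain m n :: "'a \<Rightarrow> int" where mn: "\<And>b. b \<in> B \<Longrightarrow> n b \<noteq> 0"
      "x = (\<Sum>b\<in>B. of_int (m b) / of_int (n b) * b)" by blast
    have "x = (\<Sum>b\<in>B. of_rat (Rat.Fract (m b) (n b)) * b)"
      unfolding mn(2) by (rule sum.cong) (simp_all add: mn(1) of_rat_rat)
    thus ?R by (intro exI[of _ "\<lambda>b. Rat.Fract (m b) (n b)"])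
  next
    assume ?R
    then obtain c :: "'a \<Rightarrow> rat" where c: "x = (\<Sum>b\<in>B. of_rat (c b) * b)" by blast
    have quot: "of_rat q = (of_int (fst (quotient_of q)) / of_int (snd (quotient_of q)) :: 'a)"
      and nz: "snd (quotient_of q) \<noteq> 0" for q
      using quotient_of_denom_pos'[of q] quotient_of_div[of q, OF prod.collapse[symmetric]]
      by (metis of_rat_divide of_rat_of_int_eq, simp)
    show ?L
      using nz unfolding c quot
      by (intro exI[of _ "\<lambda>b. fst (quotient_of (c b))"] exI[of _ "\<lambda>b. snd (quotient_of (c b))"]) auto
  qed
  hence "(\<forall>x. \<exists>m n :: 'a \<Rightarrow> int. (\<forall>b\<in>B. n b \<noteq> 0) \<and> x = (\<Sum>b\<in>B. of_int (m b) / of_int (n b) * b))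
     \<longleftrightarrow> rat_space.span B = UNIV" if "finite B" for B :: "'a set"
    unfolding rat_space.span_finite[OF that] by (simp only: set_eq_iff image_iff) simp
  thus ?thesis by (intro ex_cong1 conj_cong refl)
qed

lemma finite_degree: "\<exists>B :: 'k::number_field set. finite B \<and> rat_space.span B = UNIV"
  using finite_rational_span finite_rational_span_iff by blast

definition field_degree :: "'k::number_field itself \<Rightarrow> nat" where
  "field_degree _ = rat_space.dim (UNIV :: 'k set)"

definition ring_of_integers :: "'k::number_field set" where
  "ring_of_integers = {x. algebraic_int x}"

definition field_embedding :: "('k::field \<Rightarrow> complex) \<Rightarrow> bool" where
  "field_embedding \<sigma> \<longleftrightarrow> \<sigma> 1 = 1 \<and> (\<forall>x y. \<sigma> (x + y) = \<sigma> x + \<sigma> y) \<and> (\<forall>x y. \<sigma> (x * y) = \<sigma> x * \<sigma> y)"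

text \<open>
  An Archimedean place is represented by the set of the embeddings that induce it: a singleton
  for a real embedding, a conjugate pair otherwise.
\<close>

type_synonym 'k place = "('k \<Rightarrow> complex) set"

definition arch_places :: "'k::number_field place set" where
  "arch_places = {{\<sigma>, cnj \<circ> \<sigma>} | \<sigma>. field_embedding \<sigma>}"

definition real_place :: "'k place \<Rightarrow> bool" where
  "real_place v \<longleftrightarrow> (\<forall>\<sigma>\<in>v. range \<sigma> \<subseteq> \<real>)"

text \<open>
  The completion at \<open>v\<close>, as a subfield of the complex numbers; its absolute value is
  \<^const>\<open>cmod\<close>. For a complex place, \<open>place_emb v\<close> picks one of the two conjugate embeddings.
\<close>

definition completion_at :: "'k place \<Rightarrow> complex set" where
  "completion_at v = (if real_place v then \<real> else UNIV)"

definition place_emb :: "'k place \<Rightarrow> 'k \<Rightarrow> complex" where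
  "place_emb v = (SOME \<sigma>. \<sigma> \<in> v)"

subsection \<open>There are finitely many Archimedean places\<close>

lemma field_embedding_simps:
  assumes "field_embedding \<sigma>"
  shows "\<sigma> 1 = 1" "\<sigma> (x + y) = \<sigma> x + \<sigma> y" "\<sigma> (x * y) = \<sigma> x * \<sigma> y" "\<sigma> 0 = 0"
proof -
  show add: "\<sigma> 1 = 1" "\<sigma> (x + y) = \<sigma> x + \<sigma> y" "\<sigma> (x * y) = \<sigma> x * \<sigma> y" for x y
    using assms by (auto simp: field_embedding_def)
  show "\<sigma> 0 = 0" using add(2)[of 0 0] by simp
qed

lemma field_embedding_of_rat:
  fixes \<sigma> :: "'k::field_char_0 \<Rightarrow> complex"
  assumes "field_embedding \<sigma>"
  shows "\<sigma> (of_rat q) = of_rat q"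
proof -
  note [simp] = field_embedding_simps[OF assms]
  have nat: "\<sigma> (of_nat n) = of_nat n" for n by (induction n) auto
  have neg: "\<sigma> (- x) = - \<sigma> x" for x
    using field_embedding_simps(2)[OF assms, of x "- x"] by (simp add: eq_neg_iff_add_eq_0 add.commute)
  have int: "\<sigma> (of_int n) = of_int n" for n
    by (cases n rule: int_cases2) (auto simp: nat neg)
  show ?thesis
  proof (cases q)
    case (Fract a b)
    have "of_rat q * of_int b = (of_int a :: 'k)"
      using Fract by (simp add: of_rat_rat)
    hence "\<sigma> (of_rat q) * of_int b = of_int a"
      by (metis int field_embedding_simps(3)[OF assms])
    with Fract show ?thesis by (simp add: of_rat_rat field_simps)
  qed
qed

lemma field_embedding_sum:
  assumes "field_embedding \<sigma>"
  shows "\<sigma> (sum f A) = (\<Sum>a\<in>A. \<sigma> (f a))"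
  by (induction A rule: infinite_finite_induct) (auto simp: field_embedding_simps[OF assms])

lemma field_embedding_power:
  assumes "field_embedding \<sigma>"
  shows "\<sigma> (x ^ n) = \<sigma> x ^ n"
  by (induction n) (auto simp: field_embedding_simps[OF assms])

lemma number_field_algebraic:
  fixes x :: "'k::number_field"
  shows "\<exists>p :: rat poly. p \<noteq> 0 \<and> (\<Sum>i\<le>degree p. of_rat (coeff p i) * x ^ i) = 0"
proof -
  obtain B :: "'k set" where B: "finite B" "rat_space.span B = UNIV"
    using finite_degree by blast
  define n where "n = card B"
  obtain c :: "nat \<Rightarrow> rat" where c: "\<exists>i\<le>n. c i \<noteq> 0" "(\<Sum>i\<le>n. of_rat (c i) * x ^ i) = 0"
  proof (cases "inj_on (\<lambda>i. x ^ i) {..n}")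
    case True
    define P where "P = (\<lambda>i. x ^ i) ` {..n}"
    have "card P = Suc n" using True by (simp add: P_def card_image)
    hence "rat_space.dependent P"
      using rat_space.independent_span_bound[OF B(1), of P] B(2) by (auto simp: n_def)
    then obtain u where u: "(\<Sum>v\<in>P. of_rat (u v) * v) = 0" "\<exists>v\<in>P. u v \<noteq> 0"
      by (subst (asm) rat_space.dependent_finite) (auto simp: P_def)
    have "(\<Sum>i\<le>n. of_rat (u (x ^ i)) * x ^ i) = 0"
      using u(1) unfolding P_def by (subst (asm) sum.reindex[OF True]) simp
    moreover have "\<exists>i\<le>n. u (x ^ i) \<noteq> 0" using u(2) by (auto simp: P_def)
    ultimately show ?thesis using that[of "\<lambda>i. u (x ^ i)"] by blast
  next
    case False
    then obtain i j where ij: "i \<le> n" "j \<le> n" "i \<noteq> j" "x ^ i = x ^ j"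
      by (auto simp: inj_on_def)
    define c :: "nat \<Rightarrow> rat" where "c k = (if k = i then 1 else 0) - (if k = j then 1 else 0)" for k
    have "(\<Sum>k\<le>n. of_rat (c k) * x ^ k) =
          (\<Sum>k\<le>n. if k = i then x ^ k else 0) - (\<Sum>k\<le>n. if k = j then x ^ k else 0)"
      unfolding sum_subtractf[symmetric] by (rule sum.cong) (auto simp: c_def of_rat_diff)
    also have "\<dots> = 0" using ij by simp
    finally show ?thesis using ij by (intro that[of c]) (auto simp: c_def)
  qed
  define p where "p = (\<Sum>i\<le>n. monom (c i) i)"
  have coeff_p: "coeff p i = (if i \<le> n then c i else 0)" for i
    by (simp add: p_def coeff_sum if_distrib cong: if_cong)
  have "p \<noteq> 0" using c(1) coeff_p by (metis coeff_0)
  moreover have "degree p \<le> n" by (rule degree_le) (auto simp: coeff_p)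
  hence "(\<Sum>i\<le>degree p. of_rat (coeff p i) * x ^ i) = (\<Sum>i\<le>n. of_rat (coeff p i) * x ^ i)"
    by (intro sum.mono_neutral_left) (auto simp: coeff_eq_0)
  hence "(\<Sum>i\<le>degree p. of_rat (coeff p i) * x ^ i) = 0"
    using c(2) by (simp add: coeff_p)
  ultimately show ?thesis by blast
qed

lemma finite_field_embeddings: "finite {\<sigma> :: 'k::number_field \<Rightarrow> complex. field_embedding \<sigma>}"
proof -
  obtain B :: "'k set" where B: "finite B" "rat_space.span B = UNIV"
    using finite_degree by blast
  have fin: "finite ((\<lambda>\<sigma>. \<sigma> x) ` {\<sigma>. field_embedding \<sigma>})" for x :: 'k
  proof -
    obtain p :: "rat poly"
      where p: "p \<noteq> 0" "(\<Sum>i\<le>degree p. of_rat (coeff p i) * x ^ i) = 0"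
      using number_field_algebraic by blast
    define p' :: "complex poly" where "p' = map_poly of_rat p"
    have coeff_p': "coeff p' i = of_rat (coeff p i)" for i
      by (simp add: p'_def coeff_map_poly)
    have "p' \<noteq> 0" using p(1) coeff_p' by (metis leading_coeff_0_iff of_rat_eq_0_iff coeff_0)
    have deg: "degree p' = degree p"
      unfolding p'_def by (rule degree_map_poly) simp
    have "poly p' (\<sigma> x) = 0" if \<sigma>: "field_embedding \<sigma>" for \<sigma>
    proof -
      have "poly p' (\<sigma> x) = \<sigma> (\<Sum>i\<le>degree p. of_rat (coeff p i) * x ^ i)"
        by (simp add: poly_altdef deg coeff_p' field_embedding_sum[OF \<sigma>] field_embedding_simps[OF \<sigma>]
            field_embedding_of_rat[OF \<sigma>] field_embedding_power[OF \<sigma>])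
      thus ?thesis using p(2) field_embedding_simps[OF \<sigma>] by simp
    qed
    hence "(\<lambda>\<sigma>. \<sigma> x) ` {\<sigma>. field_embedding \<sigma>} \<subseteq> {z. poly p' z = 0}" by auto
    thus ?thesis using poly_roots_finite[OF \<open>p' \<noteq> 0\<close>] finite_subset by blast
  qed
  have eqI: "\<sigma> = \<tau>" if \<sigma>: "field_embedding \<sigma>" and \<tau>: "field_embedding \<tau>"
      and eq: "restrict \<sigma> B = restrict \<tau> B" for \<sigma> \<tau> :: "'k \<Rightarrow> complex"
  proof
    fix x
    have "x \<in> rat_space.span B" using B(2) by simp
    then obtain u where "x = (\<Sum>b\<in>B. of_rat (u b) * b)"
      unfolding rat_space.span_finite[OF B(1)] by blast
    moreover have "\<sigma> b = \<tau> b" if "b \<in> B" for b using eq that by (metis restrict_apply')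
    ultimately show "\<sigma> x = \<tau> x"
      by (simp add: field_embedding_sum[OF \<sigma>] field_embedding_sum[OF \<tau>]
          field_embedding_simps[OF \<sigma>] field_embedding_simps[OF \<tau>]
          field_embedding_of_rat[OF \<sigma>] field_embedding_of_rat[OF \<tau>])
  qed
  have "(\<lambda>\<sigma>. restrict \<sigma> B) ` {\<sigma>. field_embedding \<sigma>}
          \<subseteq> (\<Pi>\<^sub>E b\<in>B. (\<lambda>\<sigma>. \<sigma> b) ` {\<sigma>. field_embedding \<sigma>})" by auto
  moreover have "finite (\<Pi>\<^sub>E b\<in>B. (\<lambda>\<sigma>. \<sigma> b) ` {\<sigma> :: 'k \<Rightarrow> complex. field_embedding \<sigma>})"
    by (intro finite_PiE B(1) fin)
  ultimately have "finite ((\<lambda>\<sigma>. restrict \<sigma> B) ` {\<sigma> :: 'k \<Rightarrow> complex. field_embedding \<sigma>})"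
    using finite_subset by blast
  thus ?thesis by (rule finite_imageD) (auto intro!: inj_onI eqI)
qed

lemma finite_arch_places [simp]: "finite (arch_places :: 'k::number_field place set)"
proof -
  have *: "(arch_places :: 'k place set) = (\<lambda>\<sigma>. {\<sigma>, cnj \<circ> \<sigma>}) ` {\<sigma>. field_embedding \<sigma>}"
    by (auto simp: arch_places_def)
  show ?thesis unfolding * by (rule finite_imageI[OF finite_field_embeddings])
qed


section \<open>The product of the completions\<close>

text \<open>
  An element of \<open>K\<^sub>S\<close> is a family indexed by all sets of embeddings, with entries in the
  completions for \<open>v \<in> S\<close> and (a normalisation to get unique representatives) \<open>0\<close> elsewhere.
\<close>

typedef (overloaded) 'k KS =
  "{x :: 'k::number_field place \<Rightarrow> complex.
      (\<forall>v\<in>arch_places. x v \<in> completion_at v) \<and> (\<forall>v. v \<notin> arch_places \<longrightarrow> x v = 0)}"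
  morphisms coord KS
  by (rule exI[of _ "\<lambda>_. 0"]) (auto simp: completion_at_def)

setup_lifting type_definition_KS

lemma coord_outside: "v \<notin> arch_places \<Longrightarrow> coord x v = 0"
  using coord[of x] by simp

lemma KS_eqI:
  assumes "\<And>v. v \<in> arch_places \<Longrightarrow> coord x v = coord y v"
  shows "x = y"
proof -
  have "coord x v = coord y v" for v
    by (cases "v \<in> arch_places") (simp_all add: assms coord_outside)
  thus ?thesis by (simp add: coord_inject[symmetric] fun_eq_iff)
qed

instantiation KS :: (number_field) comm_ring
begin
lift_definition zero_KS :: "'a KS" is "\<lambda>_. 0" by (auto simp: completion_at_def)
lift_definition plus_KS :: "'a KS \<Rightarrow> 'a KS \<Rightarrow> 'a KS" is "\<lambda>x y v. x v + y v"
  by (force simp: completion_at_def)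
lift_definition minus_KS :: "'a KS \<Rightarrow> 'a KS \<Rightarrow> 'a KS" is "\<lambda>x y v. x v - y v"
  by (force simp: completion_at_def)
lift_definition uminus_KS :: "'a KS \<Rightarrow> 'a KS" is "\<lambda>x v. - x v"
  by (auto simp: completion_at_def)
lift_definition times_KS :: "'a KS \<Rightarrow> 'a KS \<Rightarrow> 'a KS" is "\<lambda>x y v. x v * y v"
  by (force simp: completion_at_def)
instance by standard (transfer; simp add: algebra_simps fun_eq_iff)+
end

instantiation KS :: (number_field) real_algebra
begin
lift_definition scaleR_KS :: "real \<Rightarrow> 'a KS \<Rightarrow> 'a KS" is "\<lambda>r x v. r *\<^sub>R x v"
  by (auto simp: completion_at_def scaleR_conv_of_real)
instance by standard (transfer; simp add: algebra_simps)+
end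

text \<open>
  The maximum is over the nonempty set \<open>S\<close> of places; inserting \<open>0\<close> does not change it and
  avoids having to prove nonemptiness at this point.
\<close>

instantiation KS :: (number_field) real_normed_algebra
begin
definition norm_KS :: "'a KS \<Rightarrow> real" where
  "norm x = Max (insert 0 ((\<lambda>v. cmod (coord x v)) ` arch_places))"
definition dist_KS_def: "dist (x :: 'a KS) y = norm (x - y)"
definition sgn_KS_def: "sgn (x :: 'a KS) = inverse (norm x) *\<^sub>R x"
definition uniformity_KS_def: "(uniformity :: ('a KS \<times> 'a KS) filter) = (INF e\<in>{0<..}. principal {(x, y). dist x y < e})"
definition open_KS_def: "open (U :: 'a KS set) \<longleftrightarrow> (\<forall>x\<in>U. \<forall>\<^sub>F (x', y) in uniformity. x' = x \<longrightarrow> y \<in> U)"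

instance
proof
  fix x y :: "'a KS" and a b :: real
  show "dist x y = norm (x - y)" "sgn x = x /\<^sub>R norm x"
    "(uniformity :: ('a KS \<times> 'a KS) filter) = (INF e\<in>{0<..}. principal {(x, y). dist x y < e})"
    by (simp_all add: dist_KS_def sgn_KS_def uniformity_KS_def)
  show "open U \<longleftrightarrow> (\<forall>x\<in>U. \<forall>\<^sub>F (x', y) in uniformity. x' = x \<longrightarrow> y \<in> U)" for U :: "'a KS set"
    by (rule open_KS_def)
  have norm_le: "norm z \<le> c \<longleftrightarrow> 0 \<le> c \<and> (\<forall>v\<in>arch_places. cmod (coord z v) \<le> c)"
    for z :: "'a KS" and c by (simp add: norm_KS_def)
  have coord_le: "cmod (coord z v) \<le> norm z" for z :: "'a KS" and v
  proof (cases "v \<in> arch_places")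
    case False
    hence "coord z v = 0" using coord[of z] by auto
    thus ?thesis by (simp add: norm_KS_def)
  qed (simp add: norm_KS_def)
  have norm_pos: "0 \<le> norm z" for z :: "'a KS" by (simp add: norm_KS_def)
  have zero: "coord (0::'a KS) v = 0" for v by transfer simp
  show "norm x = 0 \<longleftrightarrow> x = 0"
  proof
    assume "norm x = 0"
    hence "coord x v = 0" for v using coord_le[of x v] by simp
    thus "x = 0" by (intro KS_eqI) (simp add: zero)
  next
    assume "x = 0"
    hence "norm x \<le> 0" by (simp add: norm_le zero)
    thus "norm x = 0" using norm_pos[of x] by simp
  qed
  have "cmod (coord (x + y) v) \<le> norm x + norm y" for v
  proof -
    have "coord (x + y) v = coord x v + coord y v" by transfer simp
    thus ?thesis using coord_le[of x v] coord_le[of y v] norm_triangle_ineq[of "coord x v" "coord y v"]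
      by simp
  qed
  thus "norm (x + y) \<le> norm x + norm y" using norm_pos by (simp add: norm_le)
  have "cmod (coord (x * y) v) \<le> norm x * norm y" for v
  proof -
    have "coord (x * y) v = coord x v * coord y v" by transfer simp
    thus ?thesis using coord_le[of x v] coord_le[of y v] norm_pos by (simp add: norm_mult mult_mono)
  qed
  thus "norm (x * y) \<le> norm x * norm y" using norm_pos by (simp add: norm_le)
  have coord_scale: "coord (c *\<^sub>R z) v = c *\<^sub>R coord z v" for c and z :: "'a KS" and v
    by transfer simp
  have scale_le: "norm (c *\<^sub>R z) \<le> \<bar>c\<bar> * norm z" for c and z :: "'a KS"
    using norm_pos coord_le by (simp add: norm_le coord_scale mult_left_mono)
  show "norm (a *\<^sub>R x) = \<bar>a\<bar> * norm x"
  proof (cases "a = 0")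
    case True
    thus ?thesis using scale_le[of a x] norm_pos[of "a *\<^sub>R x"] by simp
  next
    case False
    hence "x = inverse a *\<^sub>R (a *\<^sub>R x)" by transfer simp
    hence "norm x \<le> \<bar>inverse a\<bar> * norm (a *\<^sub>R x)" using scale_le by metis
    hence "\<bar>a\<bar> * norm x \<le> norm (a *\<^sub>R x)" using False by (simp add: field_simps)
    thus ?thesis using scale_le[of a x] by simp
  qed
qed
end

lemma coord_simps [simp]:
  "coord 0 v = 0" "coord (x + y) v = coord x v + coord y v"
  "coord (x - y) v = coord x v - coord y v" "coord (- x) v = - coord x v"
  "coord (x * y) v = coord x v * coord y v" "coord (r *\<^sub>R x) v = r *\<^sub>R coord x v"
  by (transfer; simp)+

lemma norm_KS_le_iff: "norm x \<le> c \<longleftrightarrow> 0 \<le> c \<and> (\<forall>v\<in>arch_places. cmod (coord x v) \<le> c)"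
  by (simp add: norm_KS_def)

lemma norm_coord_le: "cmod (coord x v) \<le> norm x"
  by (cases "v \<in> arch_places") (simp_all add: norm_KS_def coord_outside)

instance KS :: (number_field) banach
proof
  fix X :: "nat \<Rightarrow> 'a KS"
  assume X: "Cauchy X"
  have "Cauchy (\<lambda>n. coord (X n) v)" for v
  proof (rule metric_CauchyI)
    fix e :: real assume "e > 0"
    then obtain N where N: "\<And>m n. m \<ge> N \<Longrightarrow> n \<ge> N \<Longrightarrow> dist (X m) (X n) < e"
      using X by (meson metric_CauchyD)
    have "dist (coord (X m) v) (coord (X n) v) < e" if "m \<ge> N" "n \<ge> N" for m n
      using N[OF that] norm_coord_le[of "X m - X n" v] by (simp add: dist_norm)
    thus "\<exists>M. \<forall>m\<ge>M. \<forall>n\<ge>M. dist (coord (X m) v) (coord (X n) v) < e" by blast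
  qed
  hence "\<exists>l. (\<lambda>n. coord (X n) v) \<longlonglongrightarrow> l" for v
    using Cauchy_convergent convergent_def by blast
  then obtain l where l: "\<And>v. (\<lambda>n. coord (X n) v) \<longlonglongrightarrow> l v" by metis
  have "l v \<in> completion_at v" if "v \<in> arch_places" for v
  proof -
    have "closed (completion_at v)" by (auto simp: completion_at_def closed_complex_Reals)
    moreover have "coord (X n) v \<in> completion_at v" for n using coord[of "X n"] that by auto
    ultimately show ?thesis using closed_sequentially[OF _ _ l[of v]] by simp
  qed
  moreover have "l v = 0" if "v \<notin> arch_places" for v
    using l[of v] by (simp add: coord_outside[OF that] LIMSEQ_const_iff)
  ultimately have coord_l: "coord (KS l) = l" by (intro KS_inverse) auto
  have "X \<longlonglongrightarrow> KS l"
  proof (rule metric_LIMSEQ_I)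
    fix e :: real assume e: "e > 0"
    have "\<forall>\<^sub>F n in sequentially. \<forall>v\<in>arch_places. dist (coord (X n) v) (l v) < e / 2"
      by (intro eventually_ball_finite finite_arch_places ballI tendstoD[OF l] half_gt_zero e)
    then obtain N where N: "\<And>n v. n \<ge> N \<Longrightarrow> v \<in> arch_places \<Longrightarrow> dist (coord (X n) v) (l v) < e / 2"
      by (auto simp: eventually_sequentially)
    have *: "norm (X n - KS l) \<le> e / 2" if "n \<ge> N" for n
      unfolding norm_KS_le_iff using N[OF that] e by (fastforce simp: coord_l dist_norm intro: less_imp_le)
    thus "\<exists>N. \<forall>n\<ge>N. dist (X n) (KS l) < e"
    proof (intro exI[of _ N] allI impI)
      fix n assume "n \<ge> N"
      from *[OF this] show "dist (X n) (KS l) < e" using e by (simp add: dist_norm)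
    qed
  qed
  thus "convergent X" by (rule convergentI)
qed


section \<open>Badly approximable \<open>S\<close>-numbers\<close>

lemma place_emb:
  assumes "v \<in> arch_places"
  shows "place_emb v \<in> v" "field_embedding (place_emb v)" "v = {place_emb v, cnj \<circ> place_emb v}"
proof -
  obtain \<sigma> where \<sigma>: "field_embedding \<sigma>" "v = {\<sigma>, cnj \<circ> \<sigma>}"
    using assms unfolding arch_places_def by blast
  show *: "place_emb v \<in> v" unfolding place_emb_def by (rule someI[of _ \<sigma>]) (simp add: \<sigma>)
  hence "place_emb v = \<sigma> \<or> place_emb v = cnj \<circ> \<sigma>" unfolding \<sigma>(2) by blast
  moreover have "field_embedding (cnj \<circ> \<sigma>)" using \<sigma>(1) by (auto simp: field_embedding_def)
  moreover have "cnj \<circ> (cnj \<circ> \<sigma>) = \<sigma>" by (auto simp: fun_eq_iff)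
  ultimately show "field_embedding (place_emb v)" "v = {place_emb v, cnj \<circ> place_emb v}"
    using \<sigma> by (metis, metis insert_commute)
qed

lemma place_emb_in_completion_at: "v \<in> arch_places \<Longrightarrow> place_emb v r \<in> completion_at v"
  using place_emb(1)[of v] by (simp add: completion_at_def real_place_def image_subset_iff)

lift_definition iota :: "'k::number_field \<Rightarrow> 'k KS" is
  "\<lambda>r v. if v \<in> arch_places then place_emb v r else 0"
  by (simp add: place_emb_in_completion_at)

definition badly_approximable :: "'k::number_field KS \<Rightarrow> bool" where
  "badly_approximable x \<longleftrightarrow>
     (\<exists>c>0. \<forall>p\<in>ring_of_integers. \<forall>q\<in>ring_of_integers - {0}.
        norm (iota q * x + iota p) > c * inverse (norm (iota q)))"

definition BA :: "'k::number_field KS set" where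
  "BA = {x. badly_approximable x}"

definition real_part_of :: "'k place set \<Rightarrow> 'k place set" where
  "real_part_of T = {v\<in>T. real_place v}"

definition complex_part_of :: "'k place set \<Rightarrow> 'k place set" where
  "complex_part_of T = {v\<in>T. \<not> real_place v}"

definition coord_subspace :: "'k::number_field KS \<Rightarrow> 'k place set \<Rightarrow> 'k KS set" where
  "coord_subspace x T = {y. \<forall>v\<in>T. coord y v = coord x v}"

definition H_K :: "'k::number_field KS set set" where
  "H_K = {coord_subspace x T | x T. x \<in> range iota \<and> T \<subseteq> arch_places \<and>
            real (card (real_part_of T) + 2 * card (complex_part_of T))
              > real (field_degree TYPE('k)) / 2}"

lemma H_K_closed_nonempty:
  fixes L :: "'k::number_field KS set"
  assumes "L \<in> H_K"
  shows "closed L" "L \<noteq> {}"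
proof -
  obtain x T where L: "L = coord_subspace x T" using assms by (auto simp: H_K_def)
  have cont: "continuous_on UNIV (\<lambda>y. coord y v)" for v :: "'k place"
    by (intro linear_continuous_on bounded_linear_intro[where K = 1]) (simp_all add: norm_coord_le)
  have "L = (\<Inter>v\<in>T. {y. coord y v = coord x v})" by (auto simp: L coord_subspace_def)
  moreover have "closed {y :: 'k KS. coord y v = coord x v}" for v
    by (intro closed_Collect_eq cont continuous_on_const)
  ultimately show "closed L" by (simp only:) (rule closed_INT, blast)
  show "L \<noteq> {}" using L by (auto simp: coord_subspace_def)
qed

end

theory Submission
  imports Defs "Jordan_Normal_Form.Determinant" "HOL-Computational_Algebra.Polynomial_Factorial"
    "HOL-Computational_Algebra.Field_as_Ring" "HOL-Computational_Algebra.Fundamental_Theorem_Algebra"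
begin

text \<open>
  For integers \<open>p\<close> and \<open>q \<noteq> 0\<close> and a scale \<open>\<rho>\<close> consider the product over the places \<open>v\<close> of
  \<open>max(|q x + p|, \<rho> |q|)\<^sup>2 / \<rho>\<close>, with real places counted once and complex places twice. If it is
  small for two pairs, then \<open>p q' - p' q\<close> has norm less than \<open>1\<close> and vanishes; hence at
  each scale at most one \<open>t = - p / q\<close> is dangerous. As \<open>\<rho>\<close> decreases, the product can decrease
  only as long as the places with \<open>|x - t| \<le> \<rho>\<close> carry more than half of the degree. Alice
  therefore deletes a neighbourhood of \<open>L(t, T)\<close>, where \<open>T\<close> is the set of places at which the
  centre of Bob's ball is close to \<open>t\<close>. Each such move pushes \<open>x\<close> away from \<open>t\<close> at one more place,
  so the product stays bounded below along the play, and this makes \<open>x\<close> badly approximable.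

  The argument needs that the norm of a nonzero integer is at least \<open>1\<close> and that the number of
  embeddings equals the degree. For the latter, the multiplication operators on the rational-linear
  maps from \<open>K\<close> to the complex numbers commute and are diagonalisable, and their joint
  eigenfunctions are the multiples of the embeddings.
\<close>

section \<open>Embeddings of a number field\<close>

definition embeddings :: "('k::number_field \<Rightarrow> complex) set" where
  "embeddings = {\<sigma>. field_embedding \<sigma>}"

lemma finite_embeddings [simp]: "finite (embeddings :: ('k::number_field \<Rightarrow> complex) set)"
  by (simp add: embeddings_def finite_field_embeddings)

section \<open>Rational-linear functions and their decomposition into eigenfunctions\<close>

definition rational_linear :: "('k::number_field \<Rightarrow> complex) \<Rightarrow> bool" where
  "rational_linear \<phi> \<longleftrightarrow>
     (\<forall>x y. \<phi> (x + y) = \<phi> x + \<phi> y) \<and> (\<forall>c x. \<phi> (of_rat c * x) = of_rat c * \<phi> x)"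

lemma rational_linear_sum:
  assumes "rational_linear \<phi>"
  shows "\<phi> (\<Sum>i\<in>A. of_rat (c i) * f i) = (\<Sum>i\<in>A. of_rat (c i) * \<phi> (f i))"
proof -
  have "\<phi> 0 = 0" using assms unfolding rational_linear_def by (metis mult_zero_left of_rat_0)
  thus ?thesis using assms
    by (induction A rule: infinite_finite_induct) (auto simp: rational_linear_def)
qed

text \<open>The field acts on functions on it by \<open>(x \<phi>)(y) = \<phi>(x y)\<close>; this is the action of \<open>P(x)\<close>.\<close>

definition poly_act :: "'k \<Rightarrow> complex poly \<Rightarrow> ('k::number_field \<Rightarrow> complex) \<Rightarrow> 'k \<Rightarrow> complex" where
  "poly_act x P \<phi> y = (\<Sum>i\<le>degree P. coeff P i * \<phi> (x ^ i * y))"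

lemma poly_act_eq:
  assumes "degree P \<le> n"
  shows "poly_act x P \<phi> y = (\<Sum>i\<le>n. coeff P i * \<phi> (x ^ i * y))"
  unfolding poly_act_def using assms by (intro sum.mono_neutral_left) (auto simp: coeff_eq_0)

text \<open>Multiplying \<open>P\<close> by the variable shifts its coefficients and trades one
  power of \<open>x\<close> for an evaluation at \<open>x * z\<close>; this peels one root off a
  product of linear factors.\<close>

lemma poly_act_linear_factor:
  "poly_act x ([:-\<mu>, 1:] * P) \<phi> y = poly_act x P (\<lambda>z. \<phi> (x * z) - \<mu> * \<phi> z) y"
proof -
  define n where "n = degree P"
  have eq: "[:-\<mu>, 1:] * P = pCons 0 P - Polynomial.smult \<mu> P" by simp
  have "degree ([:-\<mu>, 1:] * P) \<le> Suc n"
    unfolding n_def using degree_mult_le[of "[:-\<mu>, 1:]" P] by simp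
  hence "poly_act x ([:-\<mu>, 1:] * P) \<phi> y =
      (\<Sum>i\<le>Suc n. coeff (pCons 0 P - Polynomial.smult \<mu> P) i * \<phi> (x ^ i * y))"
    by (metis poly_act_eq eq)
  also have "\<dots> = (\<Sum>i\<le>Suc n. coeff (pCons 0 P) i * \<phi> (x ^ i * y))
      - \<mu> * (\<Sum>i\<le>Suc n. coeff P i * \<phi> (x ^ i * y))"
    by (simp only: sum_distrib_left sum_subtractf[symmetric] coeff_diff coeff_smult) (simp add: algebra_simps)
  also have "(\<Sum>i\<le>Suc n. coeff (pCons 0 P) i * \<phi> (x ^ i * y)) = (\<Sum>i\<le>n. coeff P i * \<phi> (x ^ Suc i * y))"
    by (subst sum.atMost_Suc_shift) simp
  also have "(\<Sum>i\<le>Suc n. coeff P i * \<phi> (x ^ i * y)) = (\<Sum>i\<le>n. coeff P i * \<phi> (x ^ i * y))"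
    by (simp add: n_def coeff_eq_0)
  finally show ?thesis
    unfolding poly_act_def n_def[symmetric]
    by (simp add: sum_distrib_left sum_subtractf algebra_simps)
qed

lemma map_poly_of_rat_mult:
  "map_poly (of_rat :: rat \<Rightarrow> 'a::field_char_0) (p * q) = map_poly of_rat p * map_poly of_rat q"
  by (rule poly_eqI) (simp add: coeff_map_poly coeff_mult of_rat_sum of_rat_mult)

lemma map_poly_of_rat_add:
  "map_poly (of_rat :: rat \<Rightarrow> 'a::field_char_0) (p + q) = map_poly of_rat p + map_poly of_rat q"
  by (rule poly_eqI) (simp add: coeff_map_poly of_rat_add)

lemma map_poly_of_rat_pderiv:
  "map_poly (of_rat :: rat \<Rightarrow> 'a::field_char_0) (pderiv p) = pderiv (map_poly of_rat p)"
  by (rule poly_eqI) (simp add: coeff_map_poly coeff_pderiv of_rat_mult of_rat_add)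

text \<open>The set \<open>\<Lambda>\<close> consists of the complex roots of a rational polynomial
  \<open>p\<close> of least degree that vanishes at \<open>x\<close>. Minimality makes
  \<open>p\<close> coprime to its derivative, so the roots are simple and the product of the linear
  factors is \<open>p\<close> up to a constant. Rational-linearity of \<open>\<phi>\<close> turns
  the vanishing of \<open>p\<close> at \<open>x\<close> into the vanishing of its action.\<close>

lemma squarefree_annihilator:
  fixes x :: "'k::number_field"
  shows "\<exists>\<Lambda>. finite \<Lambda> \<and>
    (\<forall>\<phi> y. rational_linear \<phi> \<longrightarrow> poly_act x (\<Prod>l\<in>\<Lambda>. [:-l, 1:]) \<phi> y = 0)"
proof -
  define ev :: "rat poly \<Rightarrow> 'k" where "ev q = poly (map_poly of_rat q) x" for q
  have ev_mult: "ev (q * r) = ev q * ev r" for q r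
    by (simp add: ev_def map_poly_of_rat_mult)
  have ev_eq: "ev q = (\<Sum>i\<le>degree q. of_rat (coeff q i) * x ^ i)" for q
    unfolding ev_def poly_altdef by (simp add: coeff_map_poly degree_map_poly)
  have "\<exists>q. q \<noteq> 0 \<and> ev q = 0" unfolding ev_eq using number_field_algebraic by blast
  then obtain p where p: "p \<noteq> 0" "ev p = 0"
    and p_min: "\<And>q. q \<noteq> 0 \<Longrightarrow> ev q = 0 \<Longrightarrow> degree p \<le> degree q"
    using ex_has_least_nat[of "\<lambda>q. q \<noteq> 0 \<and> ev q = 0" _ degree] by metis
  have deg_p: "degree p > 0"
  proof (rule ccontr)
    assume "\<not> degree p > 0"
    then obtain a where "p = [:a:]" by (metis degree_eq_zeroE gr0I)
    thus False using p by (simp add: ev_def map_poly_pCons)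
  qed
  define g where "g = gcd p (pderiv p)"
  have pd: "pderiv p \<noteq> 0" using deg_p by (simp add: pderiv_eq_0_iff)
  have "degree g \<le> degree (pderiv p)" unfolding g_def using pd by (intro dvd_imp_degree_le) auto
  hence "degree g < degree p" using deg_p by (simp add: degree_pderiv)
  have g0: "g \<noteq> 0" using p by (simp add: g_def)
  have "g dvd p" by (simp add: g_def)
  then obtain h where h: "p = g * h" by blast
  \<comment> \<open>The factor \<open>g\<close> has smaller degree than \<open>p\<close> and cannot
    kill \<open>x\<close>; so \<open>h\<close> does, and minimality leaves no degree for
    \<open>g\<close>.\<close>
  have "ev g \<noteq> 0" using p_min[OF g0] \<open>degree g < degree p\<close> by auto
  hence "ev h = 0" using p h ev_mult by auto
  hence "degree p \<le> degree h" using p h by (intro p_min) auto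
  hence "degree g = 0" using h p by (simp add: degree_mult_eq)
  then obtain a where a: "g = [:a:]" by (metis degree_eq_zeroE)
  with g0 have a0: "a \<noteq> 0" by auto
  obtain u v where uv: "u * p + v * pderiv p = g"
    unfolding g_def using bezout_coefficients_fst_snd[of p "pderiv p"] by blast
  define P :: "complex poly" where "P = map_poly of_rat p"
  have "map_poly of_rat g = (map_poly of_rat u * P + map_poly of_rat v * pderiv P :: complex poly)"
    unfolding uv[symmetric] P_def
    by (simp add: map_poly_of_rat_mult map_poly_of_rat_add map_poly_of_rat_pderiv)
  have "of_rat a = poly (map_poly of_rat g) z" for z :: complex
    by (simp add: a map_poly_pCons a0)
  hence const: "of_rat a = poly (map_poly of_rat u) z * poly P z + poly (map_poly of_rat v) z * poly (pderiv P) z" for z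
    by (simp only: \<open>map_poly of_rat g = _\<close> poly_add poly_mult)
  \<comment> \<open>A common root of \<open>P\<close> and its derivative would make the nonzero
    constant \<open>a\<close> of the Bezout identity vanish.\<close>
  have rsq: "rsquarefree P"
    unfolding rsquarefree_roots using const a0 by (metis add.right_neutral mult_zero_right of_rat_eq_0_iff)
  have "degree P = degree p" by (simp add: P_def degree_map_poly)
  hence P0: "P \<noteq> 0" using deg_p by auto
  define \<Lambda> where "\<Lambda> = {z. poly P z = 0}"
  have fin: "finite \<Lambda>" unfolding \<Lambda>_def by (rule poly_roots_finite[OF P0])
  have dec: "Polynomial.smult (lead_coeff P) (\<Prod>l\<in>\<Lambda>. [:-l, 1:]) = P"
    unfolding \<Lambda>_def by (rule complex_poly_decompose_rsquarefree[OF rsq])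
  have "poly_act x (\<Prod>l\<in>\<Lambda>. [:-l, 1:]) \<phi> y = 0" if \<phi>: "rational_linear \<phi>" for \<phi> y
  proof -
    have "poly_act x P \<phi> y = (\<Sum>i\<le>degree p. of_rat (coeff p i) * \<phi> (x ^ i * y))"
      by (simp add: poly_act_def P_def coeff_map_poly degree_map_poly)
    also have "\<dots> = \<phi> (\<Sum>i\<le>degree p. of_rat (coeff p i) * (x ^ i * y))"
      by (rule rational_linear_sum[OF \<phi>, symmetric])
    also have "(\<Sum>i\<le>degree p. of_rat (coeff p i) * (x ^ i * y)) = ev p * y"
      by (simp add: ev_eq sum_distrib_right mult.assoc)
    also have "\<phi> (ev p * y) = 0"
      using p rational_linear_sum[OF \<phi>, of "\<lambda>_. 0" "\<lambda>_. 0" "{}"] by simp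
    finally have 0: "poly_act x P \<phi> y = 0" .
    have "lead_coeff P * poly_act x (\<Prod>l\<in>\<Lambda>. [:-l, 1:]) \<phi> y = poly_act x (Polynomial.smult (lead_coeff P) (\<Prod>l\<in>\<Lambda>. [:-l, 1:])) \<phi> y"
      unfolding poly_act_def using P0 by (simp add: sum_distrib_left mult.assoc)
    thus ?thesis using 0 P0 by (simp add: dec)
  qed
  thus ?thesis using fin by blast
qed

text \<open>
  Induction on \<open>\<Lambda>\<close>: if \<open>\<psi> = (x - \<mu>) \<phi>\<close> is the sum of eigenfunctions \<open>f l\<close> with \<open>l \<noteq> \<mu>\<close>, then
  \<open>\<phi>\<close> minus the sum of the \<open>f l / (l - \<mu>)\<close> is an eigenfunction for \<open>\<mu>\<close>.
\<close>

lemma eigenspace_decomposition: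
  fixes x :: "'k::number_field" and S :: "('k \<Rightarrow> complex) set"
  assumes fin: "finite \<Lambda>"
    and add: "\<And>\<phi> \<psi>. \<phi> \<in> S \<Longrightarrow> \<psi> \<in> S \<Longrightarrow> (\<lambda>y. \<phi> y + \<psi> y) \<in> S"
    and scale: "\<And>c \<phi>. \<phi> \<in> S \<Longrightarrow> (\<lambda>y. c * \<phi> y) \<in> S"
    and shift: "\<And>\<phi>. \<phi> \<in> S \<Longrightarrow> (\<lambda>y. \<phi> (x * y)) \<in> S"
    and "\<phi> \<in> S" and "\<And>y. poly_act x (\<Prod>l\<in>\<Lambda>. [:-l, 1:]) \<phi> y = 0"
  shows "\<exists>f. (\<forall>l\<in>\<Lambda>. f l \<in> S \<and> (\<forall>y. f l (x * y) = l * f l y)) \<and> (\<forall>y. \<phi> y = (\<Sum>l\<in>\<Lambda>. f l y))"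
  using fin assms(5,6)
proof (induction \<Lambda> arbitrary: \<phi> rule: finite_induct)
  case empty
  have "\<phi> y = 0" for y using empty(2)[of y] by (simp add: poly_act_def)
  thus ?case by simp
next
  case (insert \<mu> \<Lambda>)
  define \<psi> where "\<psi> y = \<phi> (x * y) + (- \<mu>) * \<phi> y" for y
  have \<psi>S: "\<psi> \<in> S" unfolding \<psi>_def by (intro add shift scale insert.prems)
  have "poly_act x (\<Prod>l\<in>\<Lambda>. [:-l, 1:]) \<psi> y = 0" for y
    using insert.prems(2)[of y] insert.hyps poly_act_linear_factor[of x \<mu> "\<Prod>l\<in>\<Lambda>. [:-l, 1:]" \<phi> y]
    by (simp add: \<psi>_def[abs_def])
  from insert.IH[OF \<psi>S this] obtain f where
    f: "\<And>l. l \<in> \<Lambda> \<Longrightarrow> f l \<in> S" "\<And>l y. l \<in> \<Lambda> \<Longrightarrow> f l (x * y) = l * f l y"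
    and sum: "\<And>y. \<psi> y = (\<Sum>l\<in>\<Lambda>. f l y)" by blast
  have sum_S: "(\<lambda>y. \<Sum>l\<in>A. h l y) \<in> S" if "\<And>l. l \<in> A \<Longrightarrow> h l \<in> S" "finite A" for A :: "complex set" and h
    using that(2,1)
  proof (induction A rule: finite_induct)
    case empty
    show ?case using scale[OF \<psi>S, of 0] by simp
  next
    case (insert a A)
    have "(\<lambda>y. h a y + (\<Sum>l\<in>A. h l y)) \<in> S" by (intro add insert) auto
    thus ?case using insert.hyps by simp
  qed
  define g where "g l y = (if l = \<mu> then \<phi> y + (-1) * (\<Sum>l\<in>\<Lambda>. inverse (l - \<mu>) * f l y)
     else inverse (l - \<mu>) * f l y)" for l y
  have g\<mu>: "g \<mu> = (\<lambda>y. \<phi> y + (-1) * (\<Sum>l\<in>\<Lambda>. inverse (l - \<mu>) * f l y))"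
    and gl: "\<And>l. l \<in> \<Lambda> \<Longrightarrow> g l = (\<lambda>y. inverse (l - \<mu>) * f l y)"
    using insert.hyps by (auto simp: g_def[abs_def])
  have "g \<mu> \<in> S" unfolding g\<mu> by (intro add scale sum_S f insert.prems insert.hyps)
  moreover have "g \<mu> (x * y) = \<mu> * g \<mu> y" for y
  proof -
    have "(\<Sum>l\<in>\<Lambda>. inverse (l - \<mu>) * f l (x * y)) - \<mu> * (\<Sum>l\<in>\<Lambda>. inverse (l - \<mu>) * f l y)
        = (\<Sum>l\<in>\<Lambda>. f l y)"
      unfolding sum_distrib_left sum_subtractf[symmetric]
    proof (rule sum.cong[OF refl])
      fix l assume "l \<in> \<Lambda>"
      hence "l - \<mu> \<noteq> 0" using insert.hyps by auto
      have "inverse (l - \<mu>) * f l (x * y) - \<mu> * (inverse (l - \<mu>) * f l y) = inverse (l - \<mu>) * (l - \<mu>) * f l y"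
        unfolding f(2)[OF \<open>l \<in> \<Lambda>\<close>] by (simp add: algebra_simps)
      thus "inverse (l - \<mu>) * f l (x * y) - \<mu> * (inverse (l - \<mu>) * f l y) = f l y"
        using \<open>l - \<mu> \<noteq> 0\<close> by simp
    qed
    also have "\<dots> = \<phi> (x * y) - \<mu> * \<phi> y" using sum[of y] by (simp add: \<psi>_def)
    finally show ?thesis unfolding g\<mu> by (simp add: algebra_simps)
  qed
  moreover have "g l \<in> S \<and> (\<forall>y. g l (x * y) = l * g l y)" if "l \<in> \<Lambda>" for l
    unfolding gl[OF that] using scale[OF f(1)[OF that]]
    by (simp only: f(2)[OF that] mult.left_commute simp_thms)
  moreover have "\<phi> y = (\<Sum>l\<in>insert \<mu> \<Lambda>. g l y)" for y
  proof -
    have "(\<Sum>l\<in>\<Lambda>. g l y) = (\<Sum>l\<in>\<Lambda>. inverse (l - \<mu>) * f l y)"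
      by (intro sum.cong) (auto simp: gl)
    thus ?thesis using insert.hyps by (simp add: g\<mu>)
  qed
  ultimately show ?case by (intro exI[of _ g]) auto
qed

text \<open>The eigenvalues at the elements of \<open>B\<close> extend linearly to a function
  \<open>k\<close> on the field, and \<open>\<phi>\<close> is \<open>\<phi> 1\<close> times
  \<open>k\<close>. If \<open>\<phi> 1\<close> is nonzero, \<open>k\<close> is additive like
  \<open>\<phi>\<close> and multiplicative as a system of eigenvalues, hence an embedding.\<close>

lemma joint_eigenfunction_in_span:
  fixes \<phi> :: "'k::number_field \<Rightarrow> complex"
  assumes \<phi>: "rational_linear \<phi>" and B: "finite B" "rat_space.span B = UNIV"
    and eig: "\<And>b y. b \<in> B \<Longrightarrow> \<phi> (b * y) = \<kappa> b * \<phi> y"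
  shows "\<exists>c. \<forall>y. \<phi> y = (\<Sum>\<sigma>\<in>embeddings. c \<sigma> * \<sigma> y)"
proof -
  have eigen: "\<exists>k. \<forall>y. \<phi> (x * y) = k * \<phi> y" for x
  proof -
    have "x \<in> rat_space.span B" using B(2) by simp
    then obtain u where u: "x = (\<Sum>b\<in>B. of_rat (u b) * b)"
      unfolding rat_space.span_finite[OF B(1)] by blast
    have "\<phi> (x * y) = (\<Sum>b\<in>B. of_rat (u b) * \<kappa> b) * \<phi> y" for y
    proof -
      have "x * y = (\<Sum>b\<in>B. of_rat (u b) * (b * y))" by (simp add: u sum_distrib_right mult.assoc)
      thus ?thesis by (simp add: rational_linear_sum[OF \<phi>] eig sum_distrib_right mult.assoc)
    qed
    thus ?thesis by blast
  qed
  then obtain k where k: "\<And>x y. \<phi> (x * y) = k x * \<phi> y" by metis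
  have \<phi>k: "\<phi> x = k x * \<phi> 1" for x using k[of x 1] by simp
  show ?thesis
  proof (cases "\<phi> 1 = 0")
    case True
    hence "\<phi> y = 0" for y using \<phi>k[of y] by simp
    thus ?thesis by (intro exI[of _ "\<lambda>_. 0"]) simp
  next
    case False
    have "k 1 = 1" using \<phi>k[of 1] False by simp
    moreover have "k (x * y) = k x * k y" for x y
      using k[of x y] \<phi>k[of "x * y"] \<phi>k[of y] False by simp
    moreover have "k (x + y) = k x + k y" for x y
    proof -
      have "\<phi> (x + y) = \<phi> x + \<phi> y" using \<phi> by (simp add: rational_linear_def)
      hence "k (x + y) * \<phi> 1 = (k x + k y) * \<phi> 1" using \<phi>k by (metis distrib_right)
      thus ?thesis using False by simp
    qed
    ultimately have "k \<in> embeddings" by (simp add: embeddings_def field_embedding_def)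
    have "\<phi> y = (\<Sum>\<sigma>\<in>embeddings. (if \<sigma> = k then \<phi> 1 else 0) * \<sigma> y)" for y
    proof -
      have "(\<Sum>\<sigma>\<in>embeddings. (if \<sigma> = k then \<phi> 1 else 0) * \<sigma> y) = (\<Sum>\<sigma>\<in>embeddings. if \<sigma> = k then \<phi> 1 * \<sigma> y else 0)"
        by (intro sum.cong) auto
      thus ?thesis using \<open>k \<in> embeddings\<close> \<phi>k[of y] by simp
    qed
    thus ?thesis by (intro exI[of _ "\<lambda>\<sigma>. if \<sigma> = k then \<phi> 1 else 0"]) blast
  qed
qed

lemma embeddings_span:
  fixes \<phi> :: "'k::number_field \<Rightarrow> complex"
  assumes "rational_linear \<phi>"
  shows "\<exists>c. \<forall>y. \<phi> y = (\<Sum>\<sigma>\<in>embeddings. c \<sigma> * \<sigma> y)"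
proof -
  obtain B :: "'k set" where B: "finite B" "rat_space.span B = UNIV"
    using finite_degree by blast
  \<comment> \<open>\<open>G\<close> collects the elements at which \<open>\<phi>\<close> need not
    yet be an eigenfunction; the induction diagonalises one of them at a time.\<close>
  have "rational_linear \<phi> \<Longrightarrow> (\<And>b y. b \<in> B - G \<Longrightarrow> \<phi> (b * y) = \<kappa> b * \<phi> y) \<Longrightarrow>
      \<exists>c. \<forall>y. \<phi> y = (\<Sum>\<sigma>\<in>embeddings. c \<sigma> * \<sigma> y)" if "finite G" for G \<kappa> and \<phi> :: "'k \<Rightarrow> complex"
    using that
  proof (induction G arbitrary: \<kappa> \<phi> rule: finite_induct)
    case empty
    thus ?case by (intro joint_eigenfunction_in_span[OF empty(1) B, of \<kappa>]) auto
  next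
    case (insert g G)
    \<comment> \<open>The field is commutative, so acting by \<open>g\<close> preserves the
      eigenvalue equations already known; splitting \<open>\<phi>\<close> inside \<open>S\<close>
      keeps them for every summand.\<close>
    define S where "S = {\<psi>. rational_linear \<psi> \<and> (\<forall>b\<in>B - insert g G. \<forall>y. \<psi> (b * y) = \<kappa> b * \<psi> y)}"
    have \<phi>S: "\<phi> \<in> S" using insert.prems unfolding S_def by auto
    obtain \<Lambda> where \<Lambda>: "finite \<Lambda>" "\<And>y. poly_act g (\<Prod>l\<in>\<Lambda>. [:-l, 1:]) \<phi> y = 0"
      using squarefree_annihilator[of g] insert.prems(1) by blast
    have "\<exists>f. (\<forall>l\<in>\<Lambda>. f l \<in> S \<and> (\<forall>y. f l (g * y) = l * f l y)) \<and> (\<forall>y. \<phi> y = (\<Sum>l\<in>\<Lambda>. f l y))"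
    proof (rule eigenspace_decomposition[OF \<Lambda>(1) _ _ _ \<phi>S \<Lambda>(2)])
      show "(\<lambda>y. \<psi> (g * y)) \<in> S" if "\<psi> \<in> S" for \<psi>
        using that unfolding S_def rational_linear_def mem_Collect_eq
        by (metis distrib_left mult.left_commute)
    qed (auto simp: S_def rational_linear_def algebra_simps)
    then obtain f where f: "\<And>l. l \<in> \<Lambda> \<Longrightarrow> f l \<in> S" "\<And>l y. l \<in> \<Lambda> \<Longrightarrow> f l (g * y) = l * f l y"
      "\<And>y. \<phi> y = (\<Sum>l\<in>\<Lambda>. f l y)" by blast
    have "\<exists>c. \<forall>y. f l y = (\<Sum>\<sigma>\<in>embeddings. c \<sigma> * \<sigma> y)" if "l \<in> \<Lambda>" for l
    proof (rule insert.IH[of "f l" "\<kappa>(g := l)"])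
      show "rational_linear (f l)" using f(1)[OF that] by (simp add: S_def)
      show "f l (b * y) = (\<kappa>(g := l)) b * f l y" if "b \<in> B - G" for b y
        using f(1)[OF \<open>l \<in> \<Lambda>\<close>] f(2)[OF \<open>l \<in> \<Lambda>\<close>] that by (auto simp: S_def)
    qed
    then obtain c where c: "\<And>l y. l \<in> \<Lambda> \<Longrightarrow> f l y = (\<Sum>\<sigma>\<in>embeddings. c l \<sigma> * \<sigma> y)" by metis
    have "\<phi> y = (\<Sum>\<sigma>\<in>embeddings. (\<Sum>l\<in>\<Lambda>. c l \<sigma>) * \<sigma> y)" for y
    proof -
      have "\<phi> y = (\<Sum>l\<in>\<Lambda>. \<Sum>\<sigma>\<in>embeddings. c l \<sigma> * \<sigma> y)"
        unfolding f(3) by (intro sum.cong c) auto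
      thus ?thesis by (subst (asm) sum.swap) (simp add: sum_distrib_right)
    qed
    thus ?case by (intro exI[of _ "\<lambda>\<sigma>. \<Sum>l\<in>\<Lambda>. c l \<sigma>"]) blast
  qed
  \<comment> \<open>With \<open>G = B\<close> there is no eigenvalue equation left to
    assume.\<close>
  from this[OF B(1) assms, of "\<lambda>_. 0"] show ?thesis by simp
qed

text \<open>Artin's elimination: subtracting \<open>\<tau> z\<close> times the relation at
  \<open>y\<close> from the relation at \<open>z * y\<close> removes \<open>\<tau>\<close> and
  multiplies every other coefficient by \<open>\<sigma> z - \<tau> z\<close>, which is nonzero for
  some \<open>z\<close>.\<close>

lemma embeddings_independent:
  fixes c :: "('k::number_field \<Rightarrow> complex) \<Rightarrow> complex"
  assumes "finite A" "A \<subseteq> embeddings" "\<And>y. (\<Sum>\<sigma>\<in>A. c \<sigma> * \<sigma> y) = 0" "\<sigma> \<in> A"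
  shows "c \<sigma> = 0"
  using assms
proof (induction A arbitrary: c \<sigma> rule: finite_induct)
  case (insert \<tau> A)
  have \<tau>: "field_embedding \<tau>" and A: "\<And>\<sigma>. \<sigma> \<in> A \<Longrightarrow> field_embedding \<sigma>"
    using insert.prems(1) by (auto simp: embeddings_def)
  have cA: "c \<sigma> = 0" if "\<sigma> \<in> A" for \<sigma>
  proof -
    have "c \<sigma> * (\<sigma> z - \<tau> z) = 0" for z
    proof (rule insert.IH[where c = "\<lambda>\<sigma>. c \<sigma> * (\<sigma> z - \<tau> z)"])
      fix y
      have 1: "c \<tau> * (\<tau> z * \<tau> y) + (\<Sum>\<sigma>\<in>A. c \<sigma> * (\<sigma> z * \<sigma> y)) = 0"
        using insert.prems(2)[of "z * y"] insert.hyps insert.prems(1)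
        by (simp add: field_embedding_simps(3)[OF \<tau>] field_embedding_simps(3)[OF A] cong: sum.cong)
      have 2: "\<tau> z * (c \<tau> * \<tau> y + (\<Sum>\<sigma>\<in>A. c \<sigma> * \<sigma> y)) = 0"
        using insert.prems(2)[of y] insert.hyps by simp
      have "(\<Sum>\<sigma>\<in>A. c \<sigma> * (\<sigma> z - \<tau> z) * \<sigma> y) = (\<Sum>\<sigma>\<in>A. c \<sigma> * (\<sigma> z * \<sigma> y)) - \<tau> z * (\<Sum>\<sigma>\<in>A. c \<sigma> * \<sigma> y)"
        unfolding sum_distrib_left sum_subtractf[symmetric] by (intro sum.cong) (auto simp: algebra_simps)
      also have "\<dots> = (c \<tau> * (\<tau> z * \<tau> y) + (\<Sum>\<sigma>\<in>A. c \<sigma> * (\<sigma> z * \<sigma> y)))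
          - \<tau> z * (c \<tau> * \<tau> y + (\<Sum>\<sigma>\<in>A. c \<sigma> * \<sigma> y))"
        by (simp only: algebra_simps)
      finally show "(\<Sum>\<sigma>\<in>A. c \<sigma> * (\<sigma> z - \<tau> z) * \<sigma> y) = 0" unfolding 1 2 by simp
    qed (use insert.prems that in auto)
    moreover have "\<sigma> \<noteq> \<tau>" using that insert.hyps by auto
    then obtain z where "\<sigma> z \<noteq> \<tau> z" by (auto simp: fun_eq_iff)
    ultimately show ?thesis by (metis mult_eq_0_iff right_minus_eq)
  qed
  have "c \<tau> = 0" using insert.prems(2)[of 1] insert.hyps cA field_embedding_simps(1)[OF \<tau>] by simp
  thus ?case using cA insert.prems(3) by auto
qed simp

section \<open>Norms of integral elements\<close>

lemma rational_basis_exists: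
  "\<exists>B :: 'k::number_field set. finite B \<and> \<not> rat_space.dependent B \<and> rat_space.span B = UNIV \<and>
     card B = field_degree TYPE('k)"
proof -
  obtain A :: "'k set" where A: "finite A" "rat_space.span A = UNIV"
    using finite_degree by blast
  obtain B :: "'k set" where B: "\<not> rat_space.dependent B" "UNIV \<subseteq> rat_space.span B"
      "card B = rat_space.dim (UNIV :: 'k set)"
    using rat_space.basis_exists[of "UNIV :: 'k set"] by metis
  have "finite B" using rat_space.independent_span_bound[OF A(1) B(1)] A(2) by simp
  thus ?thesis using B by (intro exI[of _ B]) (auto simp: field_degree_def)
qed

locale rational_basis =
  fixes B :: "'k::number_field set"
  assumes finite_B: "finite B" and independent_B: "\<not> rat_space.dependent B"
    and span_B: "rat_space.span B = UNIV"
begin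

abbreviation rep :: "'k \<Rightarrow> 'k \<Rightarrow> rat" where "rep \<equiv> rat_space.representation B"

lemma rep_sum: "(\<Sum>b\<in>B. of_rat (rep y b) * b) = y"
  by (rule rat_space.sum_representation_eq) (use finite_B independent_B span_B in auto)

lemma rep_add: "rep (x + y) b = rep x b + rep y b"
  using rat_space.representation_add[OF independent_B, of y x] span_B by auto

lemma rep_scale: "rep (of_rat c * x) b = c * rep x b"
  using rat_space.representation_scale[OF independent_B, of x c] span_B by auto

lemma rep_basis: "b \<in> B \<Longrightarrow> rep b b' = (if b' = b then 1 else 0)"
  using rat_space.representation_basis[OF independent_B, of b] by auto

text \<open>Each coordinate function of the basis is rational-linear, hence a combination of
  embeddings.\<close>

lemma dual_basis_matrix:
  obtains u where "\<And>b y. of_rat (rep y b) = (\<Sum>\<sigma>\<in>embeddings. u b \<sigma> * \<sigma> y)"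
proof -
  have "rational_linear (\<lambda>y. of_rat (rep y b))" for b
    by (simp add: rational_linear_def rep_add rep_scale of_rat_add of_rat_mult)
  from embeddings_span[OF this] show thesis using that by metis
qed

text \<open>
  The matrix \<open>u\<close> of the dual basis is a left inverse of the matrix of values \<open>\<sigma> b\<close>. By independence
  of the embeddings it is also a right inverse, and the traces of the two products count the basis
  and the embeddings.
\<close>

lemma card_embeddings_eq_card_basis: "card (embeddings :: ('k \<Rightarrow> complex) set) = card B"
proof -
  obtain u where u: "\<And>b y. of_rat (rep y b) = (\<Sum>\<sigma>\<in>embeddings. u b \<sigma> * \<sigma> y)"
    using dual_basis_matrix by blast
  have inverse: "(\<Sum>b\<in>B. \<sigma> b * u b \<sigma>) = 1" if \<sigma>: "\<sigma> \<in> embeddings" for \<sigma>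
  proof -
    \<comment> \<open>\<open>c \<tau>\<close> is the deviation of an entry of the other matrix
      product from the identity. Expanding \<open>y\<close> in the basis and applying
      \<open>\<sigma>\<close> gives a relation among the embeddings with these coefficients.\<close>
    define c where "c \<tau> = (\<Sum>b\<in>B. \<sigma> b * u b \<tau>) - (if \<tau> = \<sigma> then 1 else 0)" for \<tau>
    have "(\<Sum>\<tau>\<in>embeddings. c \<tau> * \<tau> y) = 0" for y
    proof -
      have "\<sigma> y = \<sigma> (\<Sum>b\<in>B. of_rat (rep y b) * b)" by (simp only: rep_sum)
      also have "\<dots> = (\<Sum>b\<in>B. of_rat (rep y b) * \<sigma> b)"
        using \<sigma> by (simp add: embeddings_def field_embedding_sum field_embedding_simps field_embedding_of_rat)
      also have "\<dots> = (\<Sum>b\<in>B. \<Sum>\<tau>\<in>embeddings. \<sigma> b * u b \<tau> * \<tau> y)"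
        unfolding u by (simp add: sum_distrib_left sum_distrib_right mult_ac)
      also have "\<dots> = (\<Sum>\<tau>\<in>embeddings. (\<Sum>b\<in>B. \<sigma> b * u b \<tau>) * \<tau> y)"
        by (subst sum.swap) (simp add: sum_distrib_right)
      also have "\<dots> = (\<Sum>\<tau>\<in>embeddings. c \<tau> * \<tau> y + (if \<tau> = \<sigma> then \<tau> y else 0))"
        by (intro sum.cong) (auto simp: c_def algebra_simps)
      also have "\<dots> = (\<Sum>\<tau>\<in>embeddings. c \<tau> * \<tau> y) + \<sigma> y"
        using \<sigma> by (simp add: sum.distrib)
      finally show ?thesis by simp
    qed
    from embeddings_independent[OF finite_embeddings order_refl this \<sigma>] show ?thesis
      by (simp add: c_def)
  qed
  have "of_nat (card (embeddings :: ('k \<Rightarrow> complex) set)) = (\<Sum>\<sigma>\<in>embeddings. \<Sum>b\<in>B. \<sigma> b * u b \<sigma>)"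
    by (simp add: inverse)
  also have "\<dots> = (\<Sum>b\<in>B. of_rat (rep b b))"
    unfolding u by (subst sum.swap) (simp add: mult.commute)
  also have "\<dots> = of_nat (card B)" by (simp add: rep_basis)
  finally show ?thesis by (simp only: of_nat_eq_iff)
qed

text \<open>The matrix of multiplication by \<open>x\<close> factors as
  \<open>U * (D x * V)\<close>, where \<open>D x\<close> is diagonal with entries
  \<open>\<sigma> x\<close>. So the product over the embeddings is a determinant with rational
  entries, the norm of \<open>x\<close>.\<close>

lemma det_multiplication_matrix:
  obtains f where "bij_betw f {0..<card B} B"
    "\<And>x. Determinant.det (Matrix.mat (card B) (card B) (\<lambda>(i, j). of_rat (rep (x * f j) (f i)))) =
       (\<Prod>\<sigma>\<in>embeddings. \<sigma> x :: complex)"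
proof -
  define n where "n = card B"
  obtain u where u: "\<And>b y. of_rat (rep y b) = (\<Sum>\<sigma>\<in>embeddings. u b \<sigma> * \<sigma> y)"
    using dual_basis_matrix by blast
  obtain f where f: "bij_betw f {0..<n} B"
    using ex_bij_betw_nat_finite[OF finite_B] by (auto simp: n_def)
  obtain g :: "nat \<Rightarrow> 'k \<Rightarrow> complex" where g: "bij_betw g {0..<n} embeddings"
    using ex_bij_betw_nat_finite[OF finite_embeddings[where 'k = 'k]]
    by (auto simp: n_def card_embeddings_eq_card_basis)
  have gE: "field_embedding (g i)" if "i < n" for i
    using bij_betwE[OF g] that by (auto simp: embeddings_def)
  define U where "U = Matrix.mat n n (\<lambda>(i, j). u (f i) (g j))"
  define V where "V = Matrix.mat n n (\<lambda>(i, j). g i (f j))"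
  define D where "D x = Matrix.mat n n (\<lambda>(i, j). if i = j then g i x else 0)" for x
  define A where "A x = (Matrix.mat n n (\<lambda>(i, j). of_rat (rep (x * f j) (f i))) :: complex mat)" for x
  have carrier: "U \<in> carrier_mat n n" "V \<in> carrier_mat n n" "D x \<in> carrier_mat n n" "A x \<in> carrier_mat n n" for x
    by (simp_all add: U_def V_def D_def A_def)
  have DV: "D x * V = Matrix.mat n n (\<lambda>(i, j). g i (x * f j))" for x
  proof (rule eq_matI)
    fix i j assume "i < dim_row (Matrix.mat n n (\<lambda>(i, j). g i (x * f j)))"
      "j < dim_col (Matrix.mat n n (\<lambda>(i, j). g i (x * f j)))"
    hence ij: "i < n" "j < n" by simp_all
    have "(D x * V) $$ (i, j) = (\<Sum>k = 0..<n. (if i = k then g i x else 0) * g k (f j))"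
      using ij carrier by (simp add: D_def V_def scalar_prod_def)
    also have "\<dots> = (\<Sum>k = 0..<n. if i = k then g i x * g k (f j) else 0)"
      by (intro sum.cong) auto
    also have "\<dots> = g i (x * f j)"
      using ij by (simp add: field_embedding_simps[OF gE])
    finally show "(D x * V) $$ (i, j) = Matrix.mat n n (\<lambda>(i, j). g i (x * f j)) $$ (i, j)"
      using ij by simp
  qed (use carrier in auto)
  have UDV: "U * (D x * V) = A x" for x
  proof (rule eq_matI)
    fix i j assume "i < dim_row (A x)" "j < dim_col (A x)"
    hence ij: "i < n" "j < n" by (simp_all add: A_def)
    have "(U * (D x * V)) $$ (i, j) = (\<Sum>k = 0..<n. u (f i) (g k) * g k (x * f j))"
      using ij carrier by (simp add: DV U_def scalar_prod_def)
    also have "\<dots> = (\<Sum>\<sigma>\<in>embeddings. u (f i) \<sigma> * \<sigma> (x * f j))"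
      by (rule sum.reindex_bij_betw[OF g])
    finally show "(U * (D x * V)) $$ (i, j) = A x $$ (i, j)"
      using ij by (simp add: A_def u)
  qed (simp_all add: A_def U_def V_def D_def)
  have D1: "D 1 = 1\<^sub>m n"
    by (rule eq_matI) (auto simp: D_def field_embedding_simps[OF gE])
  have A1: "A 1 = 1\<^sub>m n"
  proof (rule eq_matI)
    fix i j assume "i < dim_row (1\<^sub>m n :: complex mat)" "j < dim_col (1\<^sub>m n :: complex mat)"
    hence ij: "i < n" "j < n" by simp_all
    have "f j \<in> B" "f i = f j \<longleftrightarrow> i = j"
      using bij_betwE[OF f] bij_betw_imp_inj_on[OF f] ij by (auto simp: inj_on_eq_iff)
    thus "A 1 $$ (i, j) = 1\<^sub>m n $$ (i, j)" using ij by (auto simp: A_def rep_basis)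
  qed (use carrier in auto)
  have prod: "Determinant.det (A x) = Determinant.det U * Determinant.det V * Determinant.det (D x)" for x
    unfolding UDV[symmetric] det_mult[OF carrier(1) mult_carrier_mat[OF carrier(3) carrier(2)]]
      det_mult[OF carrier(3) carrier(2)] by (simp only: mult_ac)
  \<comment> \<open>At \<open>x = 1\<close> both the multiplication matrix and \<open>D x\<close>
    are the identity, which settles the two outer determinants together.\<close>
  have "Determinant.det U * Determinant.det V = 1" using prod[of 1] by (simp add: D1 A1)
  moreover have "Determinant.det (D x) = (\<Prod>\<sigma>\<in>embeddings. \<sigma> x)" for x
  proof -
    have "Determinant.det (D x) = prod_list (diag_mat (D x))"
      by (rule det_upper_triangular[OF _ carrier(3)]) (auto simp: D_def)
    also have "\<dots> = (\<Prod>i = 0..<n. g i x)"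
      using carrier(3) by (simp add: prod_list_diag_prod D_def)
    also have "\<dots> = (\<Prod>\<sigma>\<in>embeddings. \<sigma> x)"
      by (rule prod.reindex_bij_betw[OF g])
    finally show ?thesis .
  qed
  ultimately have "Determinant.det (A x) = (\<Prod>\<sigma>\<in>embeddings. \<sigma> x)" for x
    using prod[of x] by simp
  thus thesis using that[of f] f unfolding A_def n_def by blast
qed

end

section \<open>Lower bounds for norms from finitely generated additive groups\<close>

global_interpretation int_module: Modules.module "\<lambda>(n::int) (x::'a::comm_ring_1). of_int n * x"
  by unfold_locales (simp_all add: algebra_simps)

lemma finite_rationals_common_denominator:
  assumes "finite (Q :: rat set)"
  shows "\<exists>d::int. d > 0 \<and> (\<forall>q\<in>Q. of_int d * q \<in> \<int>)"
  using assms
proof (induction Q rule: finite_induct)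
  case empty
  show ?case by (intro exI[of _ 1]) simp
next
  case (insert q Q)
  then obtain d where d: "d > 0" "\<And>q. q \<in> Q \<Longrightarrow> of_int d * q \<in> \<int>" by blast
  define e where "e = snd (quotient_of q)"
  have e: "e > 0" using quotient_of_denom_pos'[of q] by (simp add: e_def)
  have "of_int e * q = of_int (fst (quotient_of q))"
    using e quotient_of_div[of q, OF prod.collapse[symmetric]] by (simp add: e_def field_simps)
  hence eq: "of_int e * q \<in> \<int>" by simp
  have "of_int (e * d) * q' \<in> \<int>" if "q' \<in> insert q Q" for q'
  proof (cases "q' = q")
    case True
    have "of_int d * (of_int e * q) \<in> \<int>" by (rule Ints_mult[OF Ints_of_int eq])
    thus ?thesis using True by (simp add: mult_ac)
  next
    case False
    hence "of_int e * (of_int d * q') \<in> \<int>" using that by (intro Ints_mult[OF Ints_of_int d(2)]) auto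
    thus ?thesis by (simp add: mult_ac)
  qed
  thus ?case using d e by (intro exI[of _ "e * d"]) auto
qed

lemma det_in_Ints:
  fixes A :: "complex mat"
  assumes "A \<in> carrier_mat n n" "\<And>i j. i < n \<Longrightarrow> j < n \<Longrightarrow> A $$ (i, j) \<in> \<int>"
  shows "Determinant.det A \<in> \<int>"
proof -
  have "signof p \<in> (\<int> :: complex set)" for p :: "nat \<Rightarrow> nat"
    by (auto simp: sign_def)
  moreover have "(\<Prod>i = 0..<n. A $$ (i, p i)) \<in> \<int>" if "p permutes {0..<n}" for p
    using assms(2) permutes_in_image[OF that] by (intro Ints_prod) auto
  ultimately show ?thesis unfolding det_def'[OF assms(1)] by (intro Ints_sum Ints_mult) auto
qed

lemma norm_Ints_ge_1:
  assumes "z \<in> \<int>" "z \<noteq> (0::complex)"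
  shows "cmod z \<ge> 1"
  using assms by (auto elim!: Ints_cases)

text \<open>One integer \<open>d\<close> clears the denominators of the multiplication matrices of
  all elements of the additive group generated by \<open>W\<close>, so \<open>d ^ n\<close> times
  the norm of a nonzero element is a nonzero integer.\<close>

lemma prod_embeddings_bounded_denominator:
  fixes W :: "'k::number_field set"
  assumes W: "finite W"
  shows "\<exists>c>0. \<forall>z\<in>int_module.span W. z \<noteq> 0 \<longrightarrow> c \<le> (\<Prod>\<sigma>\<in>embeddings. cmod (\<sigma> z))"
proof -
  obtain B :: "'k set" where "finite B" "\<not> rat_space.dependent B" "rat_space.span B = UNIV"
    using rational_basis_exists by blast
  then interpret rational_basis B by unfold_locales
  define n where "n = card B"
  obtain f where f: "bij_betw f {0..<n} B"
    and det: "\<And>x. Determinant.det (Matrix.mat n n (\<lambda>(i, j). of_rat (rep (x * f j) (f i)))) =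
       (\<Prod>\<sigma>\<in>embeddings. \<sigma> x :: complex)"
    unfolding n_def using det_multiplication_matrix by blast
  obtain d :: int where d: "d > 0"
    and dW: "\<And>w b b'. w \<in> W \<Longrightarrow> b \<in> B \<Longrightarrow> b' \<in> B \<Longrightarrow> of_int d * rep (w * b') b \<in> \<int>"
    using finite_rationals_common_denominator[of "(\<lambda>(w, b, b'). rep (w * b') b) ` (W \<times> B \<times> B)"]
      finite_B W by (auto simp: image_iff)
  have dz: "of_int d * rep (z * b') b \<in> \<int>" if "z \<in> int_module.span W" "b \<in> B" "b' \<in> B" for z b b'
    using that(1)
  proof (induction rule: int_module.span_induct_alt)
    case base
    have "rep 0 b = 0" using rep_scale[of 0 0 b] by simp
    thus ?case by simp
  next
    case (step c x y)
    have eq: "rep ((of_int c * x + y) * b') b = of_int c * rep (x * b') b + rep (y * b') b"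
      using rep_scale[of "of_int c" "x * b'" b] by (simp add: distrib_right rep_add mult.assoc)
    have "of_int d * rep ((of_int c * x + y) * b') b = of_int c * (of_int d * rep (x * b') b) + of_int d * rep (y * b') b"
      unfolding eq by (simp only: distrib_left mult.left_commute)
    also have "\<dots> \<in> \<int>" by (intro Ints_add Ints_mult[OF Ints_of_int] step dW that)
    finally show ?case .
  qed
  have "1 / (of_int d) ^ n \<le> (\<Prod>\<sigma>\<in>embeddings. cmod (\<sigma> z))" if z: "z \<in> int_module.span W" "z \<noteq> 0" for z
  proof -
    let ?A = "Matrix.mat n n (\<lambda>(i, j). of_rat (rep (z * f j) (f i))) :: complex mat"
    have "Determinant.det (of_int d \<cdot>\<^sub>m ?A) \<in> \<int>"
    proof (rule det_in_Ints[of _ n])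
      fix i j assume ij: "i < n" "j < n"
      have "of_int d * rep (z * f j) (f i) \<in> \<int>"
        by (intro dz z) (use ij bij_betwE[OF f] in simp_all)
      then obtain k where "of_int d * rep (z * f j) (f i) = of_int k" by (elim Ints_cases)
      hence "of_rat (of_int d * rep (z * f j) (f i)) = (of_int k :: complex)" by simp
      thus "(of_int d \<cdot>\<^sub>m ?A) $$ (i, j) \<in> \<int>" using ij by (simp add: of_rat_mult)
    qed simp
    moreover have "Determinant.det (of_int d \<cdot>\<^sub>m ?A) = of_int d ^ n * (\<Prod>\<sigma>\<in>embeddings. \<sigma> z)"
      by (simp add: det)
    moreover have "\<sigma> z \<noteq> 0" if "\<sigma> \<in> embeddings" for \<sigma>
    proof
      assume "\<sigma> z = 0"
      have "\<sigma> (z * inverse z) = \<sigma> z * \<sigma> (inverse z)" "\<sigma> 1 = 1"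
        using that by (simp_all add: embeddings_def field_embedding_simps)
      thus False using z \<open>\<sigma> z = 0\<close> by simp
    qed
    ultimately have "1 \<le> cmod (of_int d ^ n * (\<Prod>\<sigma>\<in>embeddings. \<sigma> z))"
      using d by (intro norm_Ints_ge_1) auto
    also have "\<dots> = of_int d ^ n * (\<Prod>\<sigma>\<in>embeddings. cmod (\<sigma> z))"
      using d by (simp add: norm_mult norm_power prod_norm)
    finally show ?thesis using d by (simp add: field_simps)
  qed
  thus ?thesis using d by (intro exI[of _ "1 / of_int d ^ n"]) auto
qed

text \<open>The powers of an integral element have bounded denominators, so its norm cannot be below \<open>1\<close>.\<close>

lemma prod_embeddings_ge_1:
  fixes x :: "'k::number_field"
  assumes W: "finite W" "1 \<in> int_module.span W" "\<And>w. w \<in> int_module.span W \<Longrightarrow> x * w \<in> int_module.span W"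
    and "x \<noteq> 0"
  shows "1 \<le> (\<Prod>\<sigma>\<in>embeddings. cmod (\<sigma> x))"
proof (rule ccontr)
  define N where "N = (\<Prod>\<sigma>\<in>embeddings. cmod (\<sigma> x))"
  assume "\<not> 1 \<le> (\<Prod>\<sigma>\<in>embeddings. cmod (\<sigma> x))"
  hence N: "0 \<le> N" "N < 1" by (auto simp: N_def intro: prod_nonneg)
  obtain c where c: "c > 0" "\<And>z. z \<in> int_module.span W \<Longrightarrow> z \<noteq> 0 \<Longrightarrow> c \<le> (\<Prod>\<sigma>\<in>embeddings. cmod (\<sigma> z))"
    using prod_embeddings_bounded_denominator[OF W(1)] by blast
  have "x ^ m \<in> int_module.span W" for m
    by (induction m) (auto intro: W)
  moreover have "(\<Prod>\<sigma>\<in>embeddings. cmod (\<sigma> (x ^ m))) = N ^ m" for m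
    unfolding N_def prod_power_distrib
    by (intro prod.cong) (auto simp: embeddings_def field_embedding_power norm_power)
  ultimately have "c \<le> N ^ m" for m using c(2)[of "x ^ m"] \<open>x \<noteq> 0\<close> by simp
  moreover obtain m where "N ^ m < c" using real_arch_pow_inv[OF c(1) N(2)] by blast
  ultimately show False by (meson not_le)
qed

text \<open>Integral elements are adjoined one at a time: if \<open>g\<close> satisfies a monic
  equation of degree \<open>m\<close>, the products of the \<open>g ^ i\<close> with
  \<open>i < m\<close> and the old generators generate a group stable under \<open>g\<close> and
  under the earlier elements.\<close>

lemma algebraic_ints_stable_module:
  fixes G :: "'k::field_char_0 set"
  assumes "finite G" "\<And>g. g \<in> G \<Longrightarrow> algebraic_int g"
  shows "\<exists>W. finite W \<and> 1 \<in> int_module.span W \<and>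
     (\<forall>g\<in>G. \<forall>w\<in>int_module.span W. g * w \<in> int_module.span W)"
  using assms
proof (induction G rule: finite_induct)
  case empty
  show ?case by (intro exI[of _ "{1}"]) (auto intro: int_module.span_base)
next
  case (insert g G)
  then obtain W where W: "finite W" "1 \<in> int_module.span W"
    "\<And>h w. h \<in> G \<Longrightarrow> w \<in> int_module.span W \<Longrightarrow> h * w \<in> int_module.span W" by auto
  obtain p where p: "lead_coeff p = 1" "\<And>i. coeff p i \<in> \<int>" "poly p g = 0"
    using insert.prems(1)[of g] by (auto elim: algebraic_int.cases)
  define m where "m = degree p"
  \<comment> \<open>A positive degree makes the exponent \<open>0\<close> available, so that
    \<open>1\<close> stays in the new group.\<close>
  have "m > 0"
  proof (rule ccontr)
    assume "\<not> m > 0"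
    then obtain a where "p = [:a:]" unfolding m_def by (metis degree_eq_zeroE gr0I)
    thus False using p by auto
  qed
  define W' where "W' = (\<lambda>(i, w). g ^ i * w) ` ({..<m} \<times> W)"
  have low: "g ^ i * w \<in> int_module.span W'" if "i < m" "w \<in> int_module.span W" for i w
    using that(2)
  proof (induction rule: int_module.span_induct_alt)
    case base
    show ?case by (simp add: int_module.span_zero)
  next
    case (step c x y)
    have "g ^ i * x \<in> int_module.span W'"
      using that(1) step(1) by (intro int_module.span_base) (auto simp: W'_def)
    hence "of_int c * (g ^ i * x) + g ^ i * y \<in> int_module.span W'"
      by (intro int_module.span_add int_module.span_scale step)
    thus ?case by (simp add: algebra_simps)
  qed
  \<comment> \<open>Multiplication by \<open>g\<close> leaves the range of exponents only at
    \<open>g ^ m\<close>, which the monic equation replaces by lower powers.\<close>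
  have top: "g ^ m * w \<in> int_module.span W'" if "w \<in> W" for w
  proof -
    have "0 = (\<Sum>i<m. coeff p i * g ^ i) + g ^ m"
      using p(1,3) by (simp add: poly_altdef m_def lessThan_Suc_atMost[symmetric])
    hence "g ^ m = - (\<Sum>i<m. coeff p i * g ^ i)" by (metis add_eq_0_iff)
    hence "g ^ m * w = (\<Sum>i<m. (- coeff p i) * (g ^ i * w))"
      by (simp add: sum_negf sum_distrib_right mult.assoc)
    also have "\<dots> \<in> int_module.span W'"
    proof (intro int_module.span_sum)
      fix i assume "i \<in> {..<m}"
      have "- coeff p i \<in> \<int>" using p(2) by simp
      then obtain k where k: "- coeff p i = of_int k" by (elim Ints_cases)
      show "- coeff p i * (g ^ i * w) \<in> int_module.span W'"
        unfolding k using \<open>i \<in> {..<m}\<close> that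
        by (intro int_module.span_scale low int_module.span_base) auto
    qed
    finally show ?thesis .
  qed
  have stable: "h * y \<in> int_module.span W'" if h: "h \<in> insert g G" and y: "y \<in> int_module.span W'" for h y
    using y
  proof (induction rule: int_module.span_induct_alt)
    case base
    show ?case by (simp add: int_module.span_zero)
  next
    case (step c x y)
    obtain i w where iw: "x = g ^ i * w" "i < m" "w \<in> W" using step(1) by (auto simp: W'_def)
    have "h * x \<in> int_module.span W'"
    proof (cases "h = g")
      case True
      show ?thesis
      proof (cases "Suc i < m")
        case True
        thus ?thesis using low[of "Suc i" w] iw \<open>h = g\<close>
          by (simp add: int_module.span_base mult.assoc)
      next
        case False
        hence "m = Suc i" using iw by simp
        thus ?thesis using top[OF iw(3)] iw(1) \<open>h = g\<close> by (simp add: mult.assoc)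
      qed
    next
      case False
      hence "g ^ i * (h * w) \<in> int_module.span W'"
        using h iw by (intro low W) (auto intro: int_module.span_base)
      thus ?thesis by (simp only: iw(1) mult.left_commute)
    qed
    hence "of_int c * (h * x) + h * y \<in> int_module.span W'"
      by (intro int_module.span_add int_module.span_scale step)
    thus ?case by (simp add: algebra_simps)
  qed
  have "finite W'" using W by (simp add: W'_def)
  moreover have "1 \<in> int_module.span W'" using low[of 0 1] W \<open>m > 0\<close> by simp
  ultimately show ?case using stable by (intro exI[of _ W']) blast
qed

lemma prod_embeddings_integer_ge_1:
  fixes q :: "'k::number_field"
  assumes "q \<in> ring_of_integers" "q \<noteq> 0"
  shows "1 \<le> (\<Prod>\<sigma>\<in>embeddings. cmod (\<sigma> q))"
proof -
  obtain W where "finite W" "1 \<in> int_module.span W" "\<forall>w\<in>int_module.span W. q * w \<in> int_module.span W"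
    using algebraic_ints_stable_module[of "{q}"] assms by (auto simp: ring_of_integers_def)
  thus ?thesis using assms by (intro prod_embeddings_ge_1) auto
qed

text \<open>A group stable under all four elements is stable under \<open>p * q' - p' * q\<close>,
  so the norm bound applies to this element directly.\<close>

lemma prod_embeddings_det_ge_1:
  fixes p q p' q' :: "'k::number_field"
  assumes "p \<in> ring_of_integers" "q \<in> ring_of_integers" "p' \<in> ring_of_integers" "q' \<in> ring_of_integers"
    and "p * q' - p' * q \<noteq> 0"
  shows "1 \<le> (\<Prod>\<sigma>\<in>embeddings. cmod (\<sigma> (p * q' - p' * q)))"
proof -
  obtain W where W: "finite W" "1 \<in> int_module.span W"
    "\<And>g w. g \<in> {p, q, p', q'} \<Longrightarrow> w \<in> int_module.span W \<Longrightarrow> g * w \<in> int_module.span W"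
    using algebraic_ints_stable_module[of "{p, q, p', q'}"] assms(1-4)
    unfolding ring_of_integers_def by blast
  have "(p * q' - p' * q) * w \<in> int_module.span W" if "w \<in> int_module.span W" for w
  proof -
    have "p * (q' * w) - p' * (q * w) \<in> int_module.span W"
      using that by (intro int_module.span_diff W) auto
    thus ?thesis by (simp add: algebra_simps)
  qed
  thus ?thesis using assms W(1,2) by (intro prod_embeddings_ge_1) auto
qed

theorem card_embeddings: "card (embeddings :: ('k::number_field \<Rightarrow> complex) set) = field_degree TYPE('k)"
proof -
  obtain B :: "'k set" where B: "finite B" "\<not> rat_space.dependent B" "rat_space.span B = UNIV"
     "card B = field_degree TYPE('k)"
    using rational_basis_exists by blast
  then interpret rational_basis B by unfold_locales
  show ?thesis using card_embeddings_eq_card_basis B(4) by simp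
qed

section \<open>Covolumes along a decreasing sequence of scales\<close>

text \<open>
  Each \<open>v\<close> serves only scales within a factor \<open>3 / \<beta>\<close> of each other, and consecutive scales differ
  by a factor at most \<open>1 / \<beta>\<close>.
\<close>

lemma scale_ratio_bound:
  fixes r :: "nat \<Rightarrow> real" and a :: "'v \<Rightarrow> real"
  assumes \<beta>: "0 < \<beta>" "\<beta> < 1" and r: "\<And>n. 0 < r n" "\<And>n. r (Suc n) \<le> r n" "\<And>n. \<beta> * r n \<le> r (Suc n)"
    and "finite V" "n \<le> l"
    and "\<And>j. n \<le> j \<Longrightarrow> j \<le> l \<Longrightarrow> \<exists>v\<in>V. \<beta> * r j < a v \<and> a v \<le> 3 * r j"
  shows "(\<beta>\<^sup>2 / 3) ^ card V * r n \<le> r l"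
  using assms(6-)
proof (induction "card V" arbitrary: V n)
  case 0
  thus ?case by auto
next
  case (Suc k)
  have dec: "r j \<le> r i" if "i \<le> j" for i j
    using lift_Suc_antimono_le[of r, OF r(2) that] .
  define x where "x = \<beta>\<^sup>2 / 3"
  have x: "0 < x" "x < 1" using \<beta> power_less_one_iff[of \<beta> 2] by (auto simp: x_def)
  obtain v where v: "v \<in> V" "\<beta> * r n < a v" "a v \<le> 3 * r n"
    using Suc.prems(3)[of n] Suc.prems(2) by auto
  show ?case
  proof (cases "\<forall>j. n \<le> j \<and> j \<le> l \<longrightarrow> a v \<le> 3 * r j")
    case True
    have "x ^ card V \<le> x" using x power_decreasing[of 1 "card V" x] Suc.hyps(2) by simp
    also have "x \<le> \<beta> / 3" using \<beta> by (simp add: x_def power2_eq_square)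
    finally have "x ^ card V * r n \<le> \<beta> / 3 * r n" using r(1)[of n] by (intro mult_right_mono) auto
    also have "\<dots> \<le> r l" using v True Suc.prems(2) by auto
    finally show ?thesis by (simp add: x_def)
  next
    case False
    \<comment> \<open>\<open>j\<close> is the first index with \<open>r j\<close> below
      \<open>a v / 3\<close>. The index before it still has \<open>a v \<le> 3 * r i\<close>, whence
      \<open>r j\<close> is at least \<open>\<beta>\<^sup>2 / 3\<close> times \<open>r n\<close>;
      from \<open>j\<close> on \<open>v\<close> cannot serve and is removed from
      \<open>V\<close>.\<close>
    define j where "j = (LEAST j. n \<le> j \<and> j \<le> l \<and> 3 * r j < a v)"
    have j: "n \<le> j" "j \<le> l" "3 * r j < a v"
      using False LeastI_ex[of "\<lambda>j. n \<le> j \<and> j \<le> l \<and> 3 * r j < a v"] by (auto simp: j_def not_le)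
    have "j \<noteq> n" using j v by auto
    then obtain i where i: "j = Suc i" "n \<le> i" using j(1) by (metis Suc_le_D le_antisym not_less_eq_eq)
    have "\<not> 3 * r i < a v"
      using not_less_Least[of i "\<lambda>j. n \<le> j \<and> j \<le> l \<and> 3 * r j < a v"] i j(2) by (auto simp: j_def[symmetric])
    hence "\<beta> * (a v) \<le> \<beta> * (3 * r i)" using \<beta> by (intro mult_left_mono) auto
    also have "\<dots> \<le> 3 * r j" using r(3)[of i] i by simp
    finally have "\<beta> * (\<beta> * r n) \<le> 3 * r j" using mult_strict_left_mono[OF v(2) \<beta>(1)] by simp
    hence rj: "x * r n \<le> r j" by (simp add: x_def power2_eq_square mult.assoc)
    have cardV: "card (V - {v}) = k" using Suc.hyps(2) v(1) Suc.prems(1) by simp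
    have "(\<beta>\<^sup>2 / 3) ^ card (V - {v}) * r j \<le> r l"
    proof (rule Suc.hyps(1))
      fix i assume i: "j \<le> i" "i \<le> l"
      then obtain u where u: "u \<in> V" "\<beta> * r i < a u" "a u \<le> 3 * r i"
        using Suc.prems(3)[of i] j by auto
      have "a v > 3 * r i" using dec[OF i(1)] j(3) by simp
      hence "u \<noteq> v" using u by auto
      thus "\<exists>u\<in>V - {v}. \<beta> * r i < a u \<and> a u \<le> 3 * r i" using u by auto
    qed (use cardV Suc.prems j in auto)
    hence "x ^ k * r j \<le> r l" using cardV by (simp add: x_def)
    moreover have "x ^ k * (x * r n) \<le> x ^ k * r j" using rj x by (intro mult_left_mono) auto
    ultimately have "x ^ k * (x * r n) \<le> r l" by simp
    thus ?thesis using Suc.hyps(2)[symmetric] by (simp add: x_def[symmetric] mult_ac)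
  qed
qed

text \<open>
  In the application \<open>A v = |q x + p|\<close> and \<open>B v = |q|\<close> at the place \<open>v\<close>, which has weight \<open>w v\<close>.
\<close>

definition covolume :: "'v set \<Rightarrow> ('v \<Rightarrow> nat) \<Rightarrow> ('v \<Rightarrow> real) \<Rightarrow> ('v \<Rightarrow> real) \<Rightarrow> real \<Rightarrow> real" where
  "covolume S w A B \<rho> = (\<Prod>v\<in>S. ((max (A v) (\<rho> * B v))\<^sup>2 / \<rho>) ^ w v)"

text \<open>Scaling \<open>max (A v) (\<rho> * B v)\<close> by
  \<open>\<rho>' / \<rho> \<le> 1\<close> gives at most \<open>max (A v) (\<rho>' * B v)\<close>.
  After squaring and dividing by \<open>\<rho>'\<close>, each factor is seen to keep at least the
  share \<open>\<rho>' / \<rho>\<close>.\<close>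

lemma covolume_ratio:
  assumes "finite S" "\<And>v. v \<in> S \<Longrightarrow> 0 \<le> A v" "\<And>v. v \<in> S \<Longrightarrow> 0 \<le> B v" "0 < \<rho>'" "\<rho>' \<le> \<rho>"
  shows "(\<rho>' / \<rho>) ^ (\<Sum>v\<in>S. w v) * covolume S w A B \<rho> \<le> covolume S w A B \<rho>'"
proof -
  have \<rho>: "\<rho> > 0" using assms by simp
  have "(\<rho>' / \<rho>) ^ (\<Sum>v\<in>S. w v) * covolume S w A B \<rho> =
      (\<Prod>v\<in>S. ((\<rho>' / \<rho>) * ((max (A v) (\<rho> * B v))\<^sup>2 / \<rho>)) ^ w v)"
    by (simp only: covolume_def power_sum prod.distrib power_mult_distrib)
  also have "\<dots> \<le> covolume S w A B \<rho>'"
    unfolding covolume_def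
  proof (intro prod_mono conjI power_mono)
    fix v assume v: "v \<in> S"
    show "0 \<le> \<rho>' / \<rho> * ((max (A v) (\<rho> * B v))\<^sup>2 / \<rho>)" using \<rho> assms by simp
    thus "0 \<le> (\<rho>' / \<rho> * ((max (A v) (\<rho> * B v))\<^sup>2 / \<rho>)) ^ w v" by (rule zero_le_power)
    have "\<rho>' / \<rho> * max (A v) (\<rho> * B v) = max (\<rho>' / \<rho> * A v) (\<rho>' * B v)"
      using \<rho> assms(4) by (simp add: max_mult_distrib_left)
    also have "\<dots> \<le> max (A v) (\<rho>' * B v)"
      using \<rho> assms(4,5) assms(2)[OF v] mult_right_mono[of "\<rho>' / \<rho>" 1 "A v"] by auto
    finally have "(\<rho>' / \<rho> * max (A v) (\<rho> * B v))\<^sup>2 \<le> (max (A v) (\<rho>' * B v))\<^sup>2"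
      using \<rho> assms(4) assms(2)[OF v] by (intro power_mono) auto
    hence "(\<rho>' / \<rho> * max (A v) (\<rho> * B v))\<^sup>2 / \<rho>' \<le> (max (A v) (\<rho>' * B v))\<^sup>2 / \<rho>'"
      using assms(4) by (intro divide_right_mono) auto
    moreover have "(\<rho>' / \<rho> * max (A v) (\<rho> * B v))\<^sup>2 / \<rho>' = \<rho>' / \<rho> * ((max (A v) (\<rho> * B v))\<^sup>2 / \<rho>)"
      using \<rho> assms(4) by (simp add: power2_eq_square field_simps)
    ultimately show "\<rho>' / \<rho> * ((max (A v) (\<rho> * B v))\<^sup>2 / \<rho>) \<le> (max (A v) (\<rho>' * B v))\<^sup>2 / \<rho>'" by simp
  qed
  finally show ?thesis .
qed

text \<open>Let \<open>t = \<rho> / \<rho>'\<close>. Places with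
  \<open>A v \<le> \<rho> * B v\<close> lose at most a factor \<open>t\<close> per unit of weight;
  at the others the maximum stays \<open>A v\<close> and the gain is exactly \<open>t\<close>. The
  former carry at most half of the weight.\<close>

lemma covolume_antimono:
  assumes "finite S" "\<And>v. v \<in> S \<Longrightarrow> 0 \<le> A v" "\<And>v. v \<in> S \<Longrightarrow> 0 \<le> B v" "0 < \<rho>'" "\<rho>' \<le> \<rho>"
    and light: "2 * (\<Sum>v | v \<in> S \<and> A v \<le> \<rho> * B v. w v) \<le> (\<Sum>v\<in>S. w v)"
  shows "covolume S w A B \<rho> \<le> covolume S w A B \<rho>'"
proof -
  have \<rho>: "\<rho> > 0" using assms by simp
  define L where "L = {v \<in> S. A v \<le> \<rho> * B v}"
  define M where "M = {v \<in> S. \<not> A v \<le> \<rho> * B v}"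
  have split: "S = L \<union> M" "L \<inter> M = {}" "finite L" "finite M"
    using assms(1) by (auto simp: L_def M_def)
  define t where "t = \<rho> / \<rho>'"
  have t: "t \<ge> 1" using assms by (simp add: t_def)
  have L: "(1 / t) ^ sum w L * covolume L w A B \<rho> \<le> covolume L w A B \<rho>'"
    using covolume_ratio[of L A B \<rho>' \<rho> w] assms split by (auto simp: t_def)
  have M: "covolume M w A B \<rho>' = t ^ sum w M * covolume M w A B \<rho>"
  proof -
    have "covolume M w A B \<rho>' = (\<Prod>v\<in>M. (t * ((max (A v) (\<rho> * B v))\<^sup>2 / \<rho>)) ^ w v)"
      unfolding covolume_def
    proof (intro prod.cong refl arg_cong[of _ _ "\<lambda>x. x ^ _"])
      fix v assume "v \<in> M"
      hence v: "v \<in> S" "A v > \<rho> * B v" by (auto simp: M_def)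
      moreover have "\<rho>' * B v \<le> \<rho> * B v" using assms v by (intro mult_right_mono) auto
      ultimately show "(max (A v) (\<rho>' * B v))\<^sup>2 / \<rho>' = t * ((max (A v) (\<rho> * B v))\<^sup>2 / \<rho>)"
        using \<rho> assms(4) by (simp add: t_def max_def)
    qed
    also have "\<dots> = t ^ sum w M * covolume M w A B \<rho>"
      by (simp only: covolume_def power_sum prod.distrib power_mult_distrib)
    finally show ?thesis .
  qed
  have nonneg: "0 \<le> covolume T w A B \<rho>" for T
    unfolding covolume_def using \<rho> by (intro prod_nonneg) auto
  have un: "covolume S w A B \<tau> = covolume L w A B \<tau> * covolume M w A B \<tau>" for \<tau>
    unfolding covolume_def split(1) by (rule prod.union_disjoint) (use split in auto)
  have "sum w L \<le> sum w M"
    using light sum.union_disjoint[OF split(3,4,2), of w] unfolding split(1)[symmetric]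
    by (simp add: L_def[symmetric])
  hence "t ^ sum w L \<le> t ^ sum w M" using t by (intro power_increasing) auto
  hence "1 \<le> (1 / t) ^ sum w L * t ^ sum w M" using t by (simp add: power_divide field_simps)
  hence "covolume S w A B \<rho> \<le> ((1 / t) ^ sum w L * t ^ sum w M) * covolume S w A B \<rho>"
    using nonneg[of S] mult_right_mono[of 1 _ "covolume S w A B \<rho>"] by simp
  also have "\<dots> = ((1 / t) ^ sum w L * covolume L w A B \<rho>) * (t ^ sum w M * covolume M w A B \<rho>)"
    by (simp add: un)
  also have "\<dots> \<le> covolume L w A B \<rho>' * (t ^ sum w M * covolume M w A B \<rho>)"
    using L nonneg t by (intro mult_right_mono) auto
  finally show ?thesis by (simp add: un M)
qed

text \<open>
  Going down from the last scale at which the covolume is at least \<open>\<epsilon>\<close>, it can only decrease while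
  more than half of the weight is at places with \<open>A v \<le> r n * B v\<close>; by the assumption on the
  game this lasts for a bounded range of scales.
\<close>

lemma covolume_lower_bound:
  fixes r :: "nat \<Rightarrow> real" and w :: "'v \<Rightarrow> nat"
  assumes \<beta>: "0 < \<beta>" "\<beta> < 1" and r: "\<And>n. 0 < r n" "\<And>n. r (Suc n) \<le> r n" "\<And>n. \<beta> * r n \<le> r (Suc n)"
    and S: "finite S" and A: "\<And>v. v \<in> S \<Longrightarrow> 0 \<le> A v" and B: "\<And>v. v \<in> S \<Longrightarrow> 0 < B v"
    and \<epsilon>: "0 \<le> \<epsilon>" "\<epsilon> \<le> covolume S w A B (r 0)"
    and game: "\<And>n. covolume S w A B (r n) < \<epsilon> \<Longrightarrow>
       (\<Sum>v\<in>S. w v) < 2 * (\<Sum>v | v \<in> S \<and> A v \<le> r n * B v. w v) \<Longrightarrow>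
       \<exists>v\<in>S. \<beta> * r n * B v < A v \<and> A v \<le> 3 * r n * B v"
  shows "(\<beta>\<^sup>2 * (\<beta>\<^sup>2 / 3) ^ card S) ^ (\<Sum>v\<in>S. w v) * \<epsilon> \<le> covolume S w A B (r m)"
proof -
  define F where "F n = covolume S w A B (r n)" for n
  define d where "d = (\<Sum>v\<in>S. w v)"
  define x where "x = (\<beta>\<^sup>2 / 3) ^ card S"
  define heavy where "heavy n \<longleftrightarrow> d < 2 * (\<Sum>v | v \<in> S \<and> A v \<le> r n * B v. w v)" for n
  have x: "0 < x" "x \<le> 1" using \<beta> power_le_one[of \<beta> 2] by (auto simp: x_def intro: power_le_one)
  have dec: "r j \<le> r i" if "i \<le> j" for i j
    using lift_Suc_antimono_le[of r, OF r(2) that] .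
  have ratio: "c ^ d * F i \<le> F j" if "i \<le> j" "c * r i \<le> r j" "0 \<le> c" for i j c
  proof -
    have "c \<le> r j / r i" using that r(1)[of i] by (simp add: field_simps)
    hence "c ^ d * F i \<le> (r j / r i) ^ d * F i"
      using that r(1) unfolding F_def covolume_def
      by (intro mult_right_mono power_mono prod_nonneg
          zero_le_power[OF divide_nonneg_pos[OF zero_le_power2 r(1)]]) auto
    also have "\<dots> \<le> F j"
      unfolding F_def d_def using S A less_imp_le[OF B] r(1) dec[OF that(1)] by (intro covolume_ratio) auto
    finally show ?thesis .
  qed
  have step: "\<beta> ^ d * F i \<le> F (Suc i)" for i
    using ratio[of i "Suc i" \<beta>] r(3)[of i] \<beta> by simp
  have mono: "F i \<le> F j" if "i \<le> j" "\<not> heavy i" for i j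
    unfolding F_def using S A less_imp_le[OF B] r(1) dec[OF that(1)] that(2)
    by (intro covolume_antimono) (auto simp: heavy_def d_def)
  have bound: "y ^ d * \<epsilon> \<le> F m \<Longrightarrow> \<beta>\<^sup>2 * x \<le> y \<Longrightarrow> (\<beta>\<^sup>2 * x) ^ d * \<epsilon> \<le> F m" for y
    using \<epsilon>(1) x \<beta> mult_right_mono[OF power_mono[of "\<beta>\<^sup>2 * x" y d] \<epsilon>(1)] by simp
  have \<beta>2: "\<beta>\<^sup>2 \<le> \<beta>" "\<beta> \<le> 1" using \<beta> by (auto simp: power2_eq_square)
  have "(\<beta>\<^sup>2 * x) ^ d * \<epsilon> \<le> F m"
  proof (cases "\<epsilon> \<le> F m")
    case True
    show ?thesis using True x \<beta>2 \<beta> mult_mono[of "\<beta>\<^sup>2" 1 x 1] by (intro bound[of 1]) auto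
  next
    case False
    \<comment> \<open>\<open>k\<close> is the last index up to \<open>m\<close> with value at least
      \<open>\<epsilon>\<close>; index \<open>0\<close> qualifies. At most three losses follow:
      \<open>\<beta> ^ d\<close> for the next step, \<open>x ^ d\<close> for a run of heavy indices
      and \<open>\<beta> ^ d\<close> for the step to the first index that is not heavy. Beyond that
      index the values are at least the one there.\<close>
    define k where "k = (GREATEST i. i \<le> m \<and> \<epsilon> \<le> F i)"
    have k: "k \<le> m" "\<epsilon> \<le> F k"
      using GreatestI_nat[of "\<lambda>i. i \<le> m \<and> \<epsilon> \<le> F i" 0 m] \<epsilon>(2) by (auto simp: k_def F_def)
    have after: "F j < \<epsilon>" if "k < j" "j \<le> m" for j
    proof (rule ccontr)
      assume "\<not> F j < \<epsilon>"
      hence "j \<le> k" unfolding k_def using that by (intro Greatest_le_nat[of _ _ m]) auto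
      thus False using that by simp
    qed
    define n where "n = Suc k"
    have n: "n \<le> m" using k False by (cases "k = m") (auto simp: n_def)
    have "\<beta> ^ d * \<epsilon> \<le> \<beta> ^ d * F k" using k \<beta> by (intro mult_left_mono) auto
    hence Fn: "\<beta> ^ d * \<epsilon> \<le> F n" using step[of k] by (simp add: n_def)
    have run: "(\<beta> * x) ^ d * \<epsilon> \<le> F l" if l: "n \<le> l" "l \<le> m" and hv: "\<And>j. n \<le> j \<Longrightarrow> j \<le> l \<Longrightarrow> heavy j" for l
    proof -
      \<comment> \<open>In the application \<open>A v / B v\<close> is the distance from
        \<open>x\<close> to the rational point at \<open>v\<close>.\<close>
      have "x * r n \<le> r l"
        unfolding x_def
      proof (rule scale_ratio_bound[where r = r and a = "\<lambda>v. A v / B v", OF \<beta> r S l(1)])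
        fix j assume j: "n \<le> j" "j \<le> l"
        have "F j < \<epsilon>" using after[of j] j l by (simp add: n_def)
        then obtain v where "v \<in> S" "\<beta> * r j * B v < A v \<and> A v \<le> 3 * r j * B v"
          using game[of j] hv[OF j] unfolding F_def heavy_def d_def by blast
        thus "\<exists>v\<in>S. \<beta> * r j < A v / B v \<and> A v / B v \<le> 3 * r j"
          using B by (intro bexI[of _ v]) (auto simp: pos_less_divide_eq pos_divide_le_eq)
      qed
      hence "x ^ d * F n \<le> F l" using x by (intro ratio l) auto
      moreover have "x ^ d * (\<beta> ^ d * \<epsilon>) \<le> x ^ d * F n" using Fn x by (intro mult_left_mono) auto
      ultimately show ?thesis by (simp add: power_mult_distrib mult_ac)
    qed
    show ?thesis
    proof (cases "\<forall>j. n \<le> j \<and> j \<le> m \<longrightarrow> heavy j")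
      case True
      have "(\<beta> * x) ^ d * \<epsilon> \<le> F m" using True n by (intro run) auto
      thus ?thesis using \<beta>2 x by (intro bound[of "\<beta> * x"]) auto
    next
      case False
      define l where "l = (LEAST j. n \<le> j \<and> j \<le> m \<and> \<not> heavy j)"
      have l: "n \<le> l" "l \<le> m" "\<not> heavy l"
        using False LeastI_ex[of "\<lambda>j. n \<le> j \<and> j \<le> m \<and> \<not> heavy j"] by (auto simp: l_def)
      have before: "heavy j" if "n \<le> j" "j < l" for j
        using not_less_Least[of j "\<lambda>j. n \<le> j \<and> j \<le> m \<and> \<not> heavy j"] that l by (auto simp: l_def[symmetric])
      show ?thesis
      proof (cases "l = n")
        case True
        have "\<beta> ^ d * \<epsilon> \<le> F m" using Fn mono[OF l(2,3)] True by simp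
        moreover have "\<beta>\<^sup>2 * x \<le> \<beta>" using \<beta> \<beta>2 x mult_mono[of "\<beta>\<^sup>2" \<beta> x 1] by simp
        ultimately show ?thesis by (rule bound)
      next
        case False
        then obtain i where i: "l = Suc i" "n \<le> i" using l(1) by (metis Suc_le_D le_antisym not_less_eq_eq)
        have "(\<beta> * x) ^ d * \<epsilon> \<le> F i" using i l before by (intro run) auto
        hence "\<beta> ^ d * ((\<beta> * x) ^ d * \<epsilon>) \<le> \<beta> ^ d * F i" using \<beta> by (intro mult_left_mono) auto
        also have "\<dots> \<le> F l" using step[of i] i by simp
        also have "\<dots> \<le> F m" by (rule mono[OF l(2,3)])
        finally show ?thesis by (simp add: power_mult_distrib power2_eq_square mult_ac)
      qed
    qed
  qed
  thus ?thesis unfolding F_def x_def d_def .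
qed

section \<open>Rational points and Archimedean places\<close>

lemma place_eq:
  assumes "v \<in> arch_places" "\<sigma> \<in> v"
  shows "v = {\<sigma>, cnj \<circ> \<sigma>}" "\<sigma> \<in> embeddings"
proof -
  obtain \<tau> where \<tau>: "field_embedding \<tau>" "v = {\<tau>, cnj \<circ> \<tau>}"
    using assms by (auto simp: arch_places_def)
  have cc: "cnj \<circ> (cnj \<circ> \<tau>) = \<tau>" by (auto simp: fun_eq_iff)
  have "field_embedding (cnj \<circ> \<tau>)" using \<tau>(1) by (auto simp: field_embedding_def)
  thus "v = {\<sigma>, cnj \<circ> \<sigma>}" "\<sigma> \<in> embeddings"
    using assms(2) \<tau> cc by (auto simp: embeddings_def)
qed

lemma Union_arch_places: "\<Union> arch_places = (embeddings :: ('k::number_field \<Rightarrow> complex) set)"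
proof
  show "\<Union> arch_places \<subseteq> (embeddings :: ('k \<Rightarrow> complex) set)" using place_eq(2) by blast
  show "(embeddings :: ('k \<Rightarrow> complex) set) \<subseteq> \<Union> arch_places"
  proof
    fix \<sigma> :: "'k \<Rightarrow> complex" assume "\<sigma> \<in> embeddings"
    hence "{\<sigma>, cnj \<circ> \<sigma>} \<in> arch_places" by (auto simp: embeddings_def arch_places_def)
    thus "\<sigma> \<in> \<Union> arch_places" by blast
  qed
qed

lemma finite_place: "v \<in> arch_places \<Longrightarrow> finite v"
  by (auto simp: arch_places_def)

lemma arch_places_disjoint:
  assumes "v \<in> arch_places" "w \<in> arch_places" "v \<noteq> w"
  shows "v \<inter> w = {}"
  using assms place_eq(1) by blast

text \<open>The cardinality of a place is its local degree, which is why \<open>card\<close> serves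
  as the weight in the covolume.\<close>

lemma card_place:
  assumes "v \<in> arch_places"
  shows "card v = (if real_place v then 1 else 2)"
proof -
  obtain \<sigma> where \<sigma>: "v = {\<sigma>, cnj \<circ> \<sigma>}" using assms by (auto simp: arch_places_def)
  have real: "cnj \<circ> \<sigma> = \<sigma> \<longleftrightarrow> range \<sigma> \<subseteq> \<real>"
    by (auto simp: fun_eq_iff Reals_cnj_iff image_subset_iff)
  have "real_place v \<longleftrightarrow> cnj \<circ> \<sigma> = \<sigma>"
    unfolding real_place_def \<sigma> real by (auto simp: image_subset_iff)
  thus ?thesis unfolding \<sigma> by (auto simp: card_insert_if)
qed

lemma sum_card_places:
  assumes "T \<subseteq> arch_places"
  shows "(\<Sum>v\<in>T. card v) = card (real_part_of T) + 2 * card (complex_part_of T)"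
proof -
  have fin: "finite T" using assms finite_arch_places finite_subset by blast
  have "(\<Sum>v\<in>T. card v) = (\<Sum>v\<in>T. if real_place v then 1 else 2)"
    by (intro sum.cong refl card_place subsetD[OF assms])
  also have "\<dots> = card (real_part_of T) + 2 * card (complex_part_of T)"
    using fin by (simp add: sum.If_cases real_part_of_def complex_part_of_def Int_def)
  finally show ?thesis .
qed

lemma sum_card_arch_places:
  "(\<Sum>v\<in>(arch_places :: 'k::number_field place set). card v) = field_degree TYPE('k)"
proof -
  have "card (\<Union> (arch_places :: 'k place set)) = (\<Sum>v\<in>(arch_places :: 'k place set). card v)"
    using finite_place arch_places_disjoint
    by (intro card_Union_disjoint pairwiseI) (simp_all add: disjnt_def)
  thus ?thesis by (simp add: Union_arch_places card_embeddings)
qed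

lemma field_degree_pos: "field_degree TYPE('k::number_field) > 0"
proof -
  obtain B :: "'k set" where B: "finite B" "rat_space.span B = UNIV" "card B = field_degree TYPE('k)"
    using rational_basis_exists by blast
  have "B \<noteq> {}"
  proof
    assume "B = {}"
    hence "(1::'k) \<in> {0}" using B(2) by simp
    thus False by simp
  qed
  thus ?thesis using B by (metis card_gt_0_iff)
qed

text \<open>Conjugate embeddings have the same absolute value, so the members of one place
  contribute equal factors.\<close>

lemma prod_embeddings_eq_prod_places:
  "(\<Prod>\<sigma>\<in>embeddings. cmod (\<sigma> x)) = (\<Prod>v\<in>arch_places. cmod (coord (iota x) v) ^ card v)"
proof -
  have "(\<Prod>\<sigma>\<in>embeddings. cmod (\<sigma> x)) = (\<Prod>v\<in>arch_places. \<Prod>\<sigma>\<in>v. cmod (\<sigma> x))"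
    unfolding Union_arch_places[symmetric]
    by (subst prod.Union_disjoint) (use finite_place arch_places_disjoint in auto)
  also have "\<dots> = (\<Prod>v\<in>arch_places. cmod (coord (iota x) v) ^ card v)"
  proof (intro prod.cong refl)
    fix v :: "'a place" assume v: "v \<in> arch_places"
    have "cmod (\<sigma> x) = cmod (coord (iota x) v)" if "\<sigma> \<in> v" for \<sigma>
    proof -
      have "\<sigma> = place_emb v \<or> \<sigma> = cnj \<circ> place_emb v" using place_emb(3)[OF v] that by blast
      thus ?thesis using v by (auto simp: iota.rep_eq)
    qed
    thus "(\<Prod>\<sigma>\<in>v. cmod (\<sigma> x)) = cmod (coord (iota x) v) ^ card v" by simp
  qed
  finally show ?thesis .
qed

lemma iota_simps:
  "iota (x + y) = iota x + iota y" "iota (x * y) = iota x * iota y" "iota (- x) = - iota x"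
  "iota (x - y) = iota x - iota y"
proof -
  note simps = field_embedding_simps[OF place_emb(2)]
  show add: "iota (x + y) = iota x + iota y" and mult: "iota (x * y) = iota x * iota y" for x y :: 'a
    by (intro KS_eqI; simp add: iota.rep_eq simps)+
  have zero: "iota 0 = (0 :: 'a KS)" by (intro KS_eqI) (simp add: iota.rep_eq simps)
  show neg: "iota (- x) = - iota x" for x :: 'a
    using add[of x "- x"] zero by (simp add: eq_neg_iff_add_eq_0 add.commute)
  show "iota (x - y) = iota x - iota y"
    using add[of x "- y"] neg by simp
qed

lemma coord_iota_1: "v \<in> arch_places \<Longrightarrow> coord (iota 1) v = 1"
  by (simp add: iota.rep_eq field_embedding_simps[OF place_emb(2)])

lemma coord_iota_nonzero:
  assumes "v \<in> arch_places" "q \<noteq> 0"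
  shows "coord (iota q) v \<noteq> 0"
proof
  assume "coord (iota q) v = 0"
  moreover have "coord (iota (q * inverse q)) v = coord (iota q) v * coord (iota (inverse q)) v"
    by (simp add: iota_simps)
  ultimately show False using assms coord_iota_1[OF assms(1)] by simp
qed

section \<open>Covolumes of rational points\<close>

text \<open>
  Up to normalisation this is the square of the covolume of the module spanned over the ring of
  integers by the image of \<open>(q x + p, q)\<close> under the diagonal flow at time \<open>- ln \<rho> / 2\<close>.
\<close>

definition point_covolume :: "'k::number_field \<Rightarrow> 'k \<Rightarrow> 'k KS \<Rightarrow> real \<Rightarrow> real" where
  "point_covolume p q x = covolume arch_places card
     (\<lambda>v. cmod (coord (iota q * x + iota p) v)) (\<lambda>v. cmod (coord (iota q) v))"

text \<open>Keeping only \<open>\<rho> |q|\<close> in each maximum leaves \<open>\<rho> ^ d\<close>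
  times the square of the norm of \<open>q\<close>. This provides the bound at the first
  ball.\<close>

lemma point_covolume_ge:
  fixes p q :: "'k::number_field"
  assumes "q \<in> ring_of_integers" "q \<noteq> 0" "\<rho> > 0"
  shows "\<rho> ^ field_degree TYPE('k) \<le> point_covolume p q x \<rho>"
proof -
  let ?N = "\<Prod>v\<in>(arch_places :: 'k place set). cmod (coord (iota q) v) ^ card v"
  have "1 \<le> ?N" using prod_embeddings_integer_ge_1[OF assms(1,2)] by (simp add: prod_embeddings_eq_prod_places)
  hence "1 \<le> ?N\<^sup>2" by simp
  hence "\<rho> ^ field_degree TYPE('k) \<le> \<rho> ^ field_degree TYPE('k) * ?N\<^sup>2" using assms(3) by simp
  also have "\<dots> = (\<Prod>v\<in>arch_places. ((\<rho> * cmod (coord (iota q) v))\<^sup>2 / \<rho>) ^ card v)"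
  proof -
    have "(\<rho> * cmod (coord (iota q) v))\<^sup>2 / \<rho> = \<rho> * (cmod (coord (iota q) v))\<^sup>2" for v :: "'k place"
      using assms(3) by (simp add: power2_eq_square)
    thus ?thesis
      by (simp add: sum_card_arch_places[symmetric] power_sum power_mult_distrib prod.distrib
          prod_power_distrib mult.commute flip: power_mult)
  qed
  also have "\<dots> \<le> point_covolume p q x \<rho>"
    unfolding point_covolume_def covolume_def using assms(3)
    by (intro prod_mono conjI power_mono divide_right_mono zero_le_power) auto
  finally show ?thesis .
qed

text \<open>Alice sees the centre \<open>c\<close>, while the estimate concerns the limit point
  \<open>x\<close>. A move by at most \<open>\<rho>\<close> changes \<open>|q x + p|\<close> by at
  most \<open>\<rho> |q|\<close>, so each maximum at most doubles and its square grows at most by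
  the factor \<open>4\<close>.\<close>

lemma point_covolume_compare:
  fixes p q :: "'k::number_field"
  assumes "dist c x \<le> \<rho>" "\<rho> > 0"
  shows "point_covolume p q c \<rho> \<le> 4 ^ field_degree TYPE('k) * point_covolume p q x \<rho>"
proof -
  let ?m = "\<lambda>(y :: 'k KS) v. max (cmod (coord (iota q * y + iota p) v)) (\<rho> * cmod (coord (iota q) v))"
  have "point_covolume p q c \<rho> \<le> (\<Prod>v\<in>arch_places. (4 * ((?m x v)\<^sup>2 / \<rho>)) ^ card v)"
    unfolding point_covolume_def covolume_def
  proof (intro prod_mono conjI power_mono)
    fix v :: "'k place"
    have "coord (iota q * c + iota p) v = coord (iota q * x + iota p) v + coord (iota q) v * coord (c - x) v"
      by (simp add: algebra_simps)
    hence "cmod (coord (iota q * c + iota p) v) \<le>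
        cmod (coord (iota q * x + iota p) v) + cmod (coord (iota q) v) * cmod (coord (c - x) v)"
      by (metis norm_triangle_ineq norm_mult)
    also have "cmod (coord (iota q) v) * cmod (coord (c - x) v) \<le> cmod (coord (iota q) v) * \<rho>"
      using assms norm_coord_le[of "c - x" v] by (intro mult_left_mono) (auto simp: dist_norm)
    finally have "cmod (coord (iota q * c + iota p) v) \<le>
        cmod (coord (iota q * x + iota p) v) + \<rho> * cmod (coord (iota q) v)"
      by (simp only: mult.commute)
    moreover have "0 \<le> \<rho> * cmod (coord (iota q) v)" using assms(2) by simp
    ultimately have "?m c v \<le> 2 * ?m x v"
      using norm_ge_zero[of "coord (iota q * x + iota p) v"] by linarith
    hence "(?m c v)\<^sup>2 \<le> (2 * ?m x v)\<^sup>2" by (intro power_mono) (auto simp: le_max_iff_disj)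
    hence "(?m c v)\<^sup>2 / \<rho> \<le> (2 * ?m x v)\<^sup>2 / \<rho>" using assms(2) by (intro divide_right_mono) auto
    thus "(?m c v)\<^sup>2 / \<rho> \<le> 4 * ((?m x v)\<^sup>2 / \<rho>)" by (simp add: power_mult_distrib)
    show "0 \<le> (?m c v)\<^sup>2 / \<rho>" "0 \<le> ((?m c v)\<^sup>2 / \<rho>) ^ card v" using assms(2) by auto
  qed
  also have "\<dots> = 4 ^ field_degree TYPE('k) * point_covolume p q x \<rho>"
    by (simp only: point_covolume_def covolume_def sum_card_arch_places[symmetric] power_sum prod.distrib power_mult_distrib)
  finally show ?thesis .
qed

text \<open>The identity \<open>p q' - p' q = (q x + p) q' - (q' x + p') q\<close> bounds the
  determinant at every place by twice the product of the two maxima divided by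
  \<open>\<rho>\<close>. Its norm is then below \<open>1\<close>, so it vanishes.\<close>

lemma point_covolume_unique:
  fixes p q p' q' :: "'k::number_field"
  assumes "p \<in> ring_of_integers" "q \<in> ring_of_integers" "p' \<in> ring_of_integers" "q' \<in> ring_of_integers"
    and \<rho>: "\<rho> > 0"
    and small: "4 ^ field_degree TYPE('k) * (point_covolume p q x \<rho> * point_covolume p' q' x \<rho>) < 1"
  shows "p * q' = p' * q"
proof (rule ccontr)
  assume "p * q' \<noteq> p' * q"
  define z where "z = p * q' - p' * q"
  let ?m = "\<lambda>p q v. max (cmod (coord (iota q * x + iota p) v)) (\<rho> * cmod (coord (iota q) v))"
  let ?N = "\<Prod>v\<in>(arch_places :: 'k place set). cmod (coord (iota z) v) ^ card v"
  have "1 \<le> ?N"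
    using prod_embeddings_det_ge_1[OF assms(1-4)] \<open>p * q' \<noteq> p' * q\<close>
    by (simp add: prod_embeddings_eq_prod_places z_def)
  hence "1 \<le> ?N\<^sup>2" by simp
  also have "?N\<^sup>2 = (\<Prod>v\<in>arch_places. ((cmod (coord (iota z) v))\<^sup>2) ^ card v)"
    by (simp add: prod_power_distrib mult.commute flip: power_mult)
  also have "\<dots> \<le> (\<Prod>v\<in>arch_places. (4 * ((?m p q v)\<^sup>2 / \<rho> * ((?m p' q' v)\<^sup>2 / \<rho>))) ^ card v)"
  proof (intro prod_mono conjI power_mono)
    fix v :: "'k place"
    have "coord (iota z) v = coord (iota q * x + iota p) v * coord (iota q') v
        - coord (iota q' * x + iota p') v * coord (iota q) v"
      by (simp add: z_def iota_simps algebra_simps)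
    hence "cmod (coord (iota z) v) \<le> cmod (coord (iota q * x + iota p) v) * cmod (coord (iota q') v)
        + cmod (coord (iota q' * x + iota p') v) * cmod (coord (iota q) v)"
      by (metis norm_triangle_ineq4 norm_mult)
    also have "cmod (coord (iota q * x + iota p) v) * cmod (coord (iota q') v) \<le> ?m p q v * (?m p' q' v / \<rho>)"
      using \<rho> by (intro mult_mono) (auto simp: field_simps le_max_iff_disj)
    also have "cmod (coord (iota q' * x + iota p') v) * cmod (coord (iota q) v) \<le> ?m p' q' v * (?m p q v / \<rho>)"
      using \<rho> by (intro mult_mono) (auto simp: field_simps le_max_iff_disj)
    finally have "cmod (coord (iota z) v) \<le> 2 * (?m p q v * (?m p' q' v / \<rho>))" by simp
    hence "(cmod (coord (iota z) v))\<^sup>2 \<le> (2 * (?m p q v * (?m p' q' v / \<rho>)))\<^sup>2" by (intro power_mono) auto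
    also have "\<dots> = 4 * ((?m p q v)\<^sup>2 / \<rho> * ((?m p' q' v)\<^sup>2 / \<rho>))"
      using \<rho> by (simp add: power_mult_distrib power_divide power2_eq_square)
    finally show "(cmod (coord (iota z) v))\<^sup>2 \<le> 4 * ((?m p q v)\<^sup>2 / \<rho> * ((?m p' q' v)\<^sup>2 / \<rho>))" .
  qed auto
  also have "\<dots> = 4 ^ field_degree TYPE('k) * (point_covolume p q x \<rho> * point_covolume p' q' x \<rho>)"
    by (simp only: point_covolume_def covolume_def sum_card_arch_places[symmetric] power_sum prod.distrib power_mult_distrib)
  finally show False using small by simp
qed

section \<open>Bad approximability from a lower bound on covolumes\<close>

lemma norm_iota_ge_1:
  fixes q :: "'k::number_field"
  assumes "q \<in> ring_of_integers" "q \<noteq> 0"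
  shows "norm (iota q) \<ge> 1"
proof (rule ccontr)
  assume "\<not> norm (iota q) \<ge> 1"
  have "1 \<le> (\<Prod>v\<in>arch_places. cmod (coord (iota q) v) ^ card v)"
    using prod_embeddings_integer_ge_1[OF assms] by (simp add: prod_embeddings_eq_prod_places)
  also have "\<dots> \<le> (\<Prod>v\<in>(arch_places :: 'k place set). norm (iota q) ^ card v)"
    by (intro prod_mono conjI power_mono norm_coord_le) auto
  also have "\<dots> = norm (iota q) ^ field_degree TYPE('k)"
    by (simp add: sum_card_arch_places[symmetric] power_sum)
  also have "\<dots> < 1"
    using \<open>\<not> norm (iota q) \<ge> 1\<close> field_degree_pos[where 'k = 'k] by (subst power_less_one_iff) auto
  finally show False by simp
qed

text \<open>Suppose \<open>|q x + p| \<le> c / Q\<close> at all places, where \<open>Q\<close> is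
  the norm of \<open>iota q\<close>. At a scale comparable to \<open>c / Q\<^sup>2\<close> both
  entries of every maximum are at most \<open>c / Q\<close>, and the covolume is at most
  \<open>(c / \<beta>) ^ d\<close>.\<close>

lemma BA_if_point_covolume_bounded_below:
  fixes x :: "'k::number_field KS"
  assumes \<beta>: "0 < \<beta>" and r: "\<And>n. 0 < r n" "\<And>n. \<beta> * r n \<le> r (Suc n)" "r \<longlonglongrightarrow> 0"
    and \<delta>: "\<delta> > 0" "\<And>p q n. p \<in> ring_of_integers \<Longrightarrow> q \<in> ring_of_integers \<Longrightarrow> q \<noteq> 0 \<Longrightarrow> \<delta> \<le> point_covolume p q x (r n)"
    and "\<beta> < 1"
  shows "x \<in> BA"
proof -
  \<comment> \<open>The bound by \<open>r 0\<close> ensures that the first scale not above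
    \<open>c / Q\<^sup>2\<close> is at least \<open>\<beta>\<close> times it. The other bounds give
    \<open>(c / \<beta>) ^ d \<le> c / \<beta> < \<delta>\<close>.\<close>
  define c where "c = min (r 0) (\<beta> * min (1 / 2) (\<delta> / 2))"
  have "c \<le> \<beta> * min (1 / 2) (\<delta> / 2)" by (simp add: c_def)
  hence "c / \<beta> \<le> min (1 / 2) (\<delta> / 2)" using \<beta> by (simp only: pos_divide_le_eq mult.commute)
  hence c: "c > 0" "c \<le> r 0" "c / \<beta> \<le> 1 / 2" "c / \<beta> \<le> \<delta> / 2"
    using r(1)[of 0] \<beta> \<delta>(1) by (auto simp: c_def)
  have "norm (iota q * x + iota p) > c * inverse (norm (iota q))"
    if p: "p \<in> ring_of_integers" and q: "q \<in> ring_of_integers" "q \<noteq> 0" for p q :: 'k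
  proof (rule ccontr)
    assume "\<not> norm (iota q * x + iota p) > c * inverse (norm (iota q))"
    define Q where "Q = norm (iota q)"
    have Q: "Q \<ge> 1" unfolding Q_def by (rule norm_iota_ge_1[OF q])
    have small: "norm (iota q * x + iota p) \<le> c / Q"
      using \<open>\<not> norm (iota q * x + iota p) > c * inverse (norm (iota q))\<close> by (simp add: Q_def divide_inverse)
    have cQ: "0 < c / Q\<^sup>2" "c / Q\<^sup>2 \<le> c" using c Q by (auto simp: field_simps)
    obtain n where "r n < c / Q\<^sup>2"
      using order_tendstoD(2)[OF r(3) cQ(1)] by (auto simp: eventually_sequentially)
    define m where "m = (LEAST n. r n \<le> c / Q\<^sup>2)"
    have m: "r m \<le> c / Q\<^sup>2" unfolding m_def by (rule LeastI[of _ n]) (use \<open>r n < _\<close> in auto)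
    have m': "\<beta> * (c / Q\<^sup>2) \<le> r m"
    proof (cases m)
      case 0
      have "\<beta> * (c / Q\<^sup>2) \<le> 1 * (c / Q\<^sup>2)" using \<beta> \<open>\<beta> < 1\<close> cQ(1) by (intro mult_right_mono) auto
      also have "\<dots> \<le> r 0" using c cQ by simp
      finally show ?thesis using 0 by simp
    next
      case (Suc i)
      hence "\<not> r i \<le> c / Q\<^sup>2" unfolding m_def by (intro not_less_Least) (simp add: m_def[symmetric])
      hence "\<beta> * (c / Q\<^sup>2) \<le> \<beta> * r i" using \<beta> by (intro mult_left_mono) auto
      also have "\<dots> \<le> r m" using r(2)[of i] Suc by simp
      finally show ?thesis .
    qed
    have "point_covolume p q x (r m) \<le> (\<Prod>v\<in>(arch_places :: 'k place set). (c / \<beta>) ^ card v)"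
      unfolding point_covolume_def covolume_def
    proof (intro prod_mono conjI power_mono)
      fix v :: "'k place"
      have "r m * cmod (coord (iota q) v) \<le> c / Q\<^sup>2 * Q"
        unfolding Q_def using m r(1)[of m] by (intro mult_mono norm_coord_le) (auto simp: Q_def)
      also have "\<dots> = c / Q" using Q by (simp add: power2_eq_square)
      finally have "max (cmod (coord (iota q * x + iota p) v)) (r m * cmod (coord (iota q) v)) \<le> c / Q"
        using norm_coord_le[of "iota q * x + iota p" v] small by simp
      hence "(max (cmod (coord (iota q * x + iota p) v)) (r m * cmod (coord (iota q) v)))\<^sup>2 \<le> (c / Q)\<^sup>2"
        by (intro power_mono) (auto simp: le_max_iff_disj)
      also have "\<dots> = c / \<beta> * (\<beta> * (c / Q\<^sup>2))" using \<beta> by (simp add: power2_eq_square)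
      also have "\<dots> \<le> c / \<beta> * r m" using m' c \<beta> by (intro mult_left_mono) auto
      finally show "(max (cmod (coord (iota q * x + iota p) v)) (r m * cmod (coord (iota q) v)))\<^sup>2 / r m \<le> c / \<beta>"
        using r(1)[of m] by (simp add: pos_divide_le_eq)
    qed (use less_imp_le[OF r(1)] in auto)
    also have "\<dots> = (c / \<beta>) ^ field_degree TYPE('k)"
      by (simp add: sum_card_arch_places[symmetric] power_sum)
    also have "\<dots> \<le> (c / \<beta>) ^ 1"
      using c \<beta> field_degree_pos[where 'k = 'k] by (intro power_decreasing) auto
    also have "\<dots> < \<delta>" using c(4) \<delta>(1) unfolding power_one_right by linarith
    finally show False using \<delta>(2)[OF p q, of m] by simp
  qed
  thus ?thesis unfolding BA_def badly_approximable_def using c(1) by blast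
qed

section \<open>The game\<close>

lemma bob_legal_upto_Suc:
  "bob_legal_upto Y \<beta> s B (Suc n) \<longleftrightarrow>
     bob_legal_upto Y \<beta> s B n \<and> bob_next Y \<beta> (B n) (alice_reply s B n) (B (Suc n))"
  by (auto simp: bob_legal_upto_def less_Suc_eq)

text \<open>Supplies a play in which Bob always shrinks by the factor \<open>\<beta>\<close>, so
  that for \<open>\<beta> < 1\<close> his radii tend to \<open>0\<close>.\<close>

lemma play_exists:
  fixes s :: "'a::complete_space strategy"
  assumes "\<And>B n. bob_legal_upto Y \<beta> s B n \<Longrightarrow>
      \<exists>B'. bob_next Y \<beta> (B n) (alice_reply s B n) B' \<and> snd B' = \<beta> * snd (B n)"
    and "bob_first Y b"
  obtains B where "B 0 = b" "\<And>n. bob_legal_upto Y \<beta> s B n" "\<And>n. snd (B (Suc n)) = \<beta> * snd (B n)"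
proof -
  define f where "f l = (SOME B'. bob_next Y \<beta> (last l) (s l) B' \<and> snd B' = \<beta> * snd (last l))" for l
  \<comment> \<open>The recursion carries the whole list of Bob's moves, because a strategy is a
    function of that list.\<close>
  define L where "L = rec_nat [b] (\<lambda>_ l. l @ [f l])"
  have L: "L 0 = [b]" "L (Suc n) = L n @ [f (L n)]" for n by (simp_all add: L_def)
  define B where "B n = last (L n)" for n
  have hist: "map B [0..<Suc n] = L n" for n
    by (induction n) (simp_all add: B_def L)
  have reply: "alice_reply s B n = s (L n)" for n
    unfolding alice_reply_def hist ..
  have step: "bob_next Y \<beta> (B n) (alice_reply s B n) (B (Suc n)) \<and> snd (B (Suc n)) = \<beta> * snd (B n)"
    if "bob_legal_upto Y \<beta> s B n" for n
  proof -
    have "B (Suc n) = f (L n)" by (simp add: B_def L)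
    thus ?thesis
      using someI_ex[OF assms(1)[OF that]] unfolding f_def reply B_def by simp
  qed
  have legal: "bob_legal_upto Y \<beta> s B n" for n
  proof (induction n)
    case 0
    show ?case using assms(2) by (simp add: bob_legal_upto_def B_def L)
  next
    case (Suc n)
    thus ?case using step by (simp add: bob_legal_upto_Suc)
  qed
  show thesis using that[of B] legal step by (simp add: B_def L)
qed

text \<open>The order on formal balls telescopes: centres move by at most the loss of radius, so
  they form a Cauchy sequence. Keeping the limit radius \<open>\<rho>\<close> in the estimate shows
  that the ball of radius \<open>\<rho>\<close> about \<open>x\<close> lies in all of Bob's
  balls.\<close>

lemma play_limit:
  fixes B :: "nat \<Rightarrow> 'a::complete_space formal_ball"
  assumes legal: "\<And>n. bob_legal_upto Y \<beta> s B n"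
  obtains x \<rho> where "\<rho> \<ge> 0" "(\<lambda>n. snd (B n)) \<longlonglongrightarrow> \<rho>" "\<And>n. dist x (fst (B n)) \<le> snd (B n) - \<rho>"
proof -
  define c where "c n = fst (B n)" for n
  define r where "r n = snd (B n)" for n
  have step: "dist (c (Suc n)) (c n) \<le> r n - r (Suc n)" "r (Suc n) > 0" for n
    using legal[of "Suc n"] by (auto simp: bob_legal_upto_Suc bob_next_def formal_le_def c_def r_def)
  have nonneg: "0 \<le> r n" for n
    using legal[of 0] step(2)[of "n - 1"] by (cases n) (auto simp: bob_legal_upto_def bob_first_def r_def)
  have dec: "decseq r"
  proof (rule decseq_SucI)
    show "r (Suc n) \<le> r n" for n using step(1)[of n] zero_le_dist[of "c (Suc n)" "c n"] by linarith
  qed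
  obtain \<rho> where \<rho>: "r \<longlonglongrightarrow> \<rho>" using decseq_convergent[OF dec] nonneg by metis
  have \<rho>0: "\<rho> \<ge> 0" using LIMSEQ_le_const[OF \<rho>] nonneg by blast
  have dist: "dist (c (n + k)) (c n) \<le> r n - r (n + k)" for n k
  proof (induction k)
    case (Suc k)
    thus ?case using step(1)[of "n + k"] dist_triangle[of "c (Suc (n + k))" "c n" "c (n + k)"] by simp
  qed simp
  have "Cauchy c"
  proof (rule metric_CauchyI)
    fix e :: real assume "e > 0"
    then obtain N where N: "\<And>n. n \<ge> N \<Longrightarrow> dist (r n) \<rho> < e / 2"
      using metric_LIMSEQ_D[OF \<rho>, of "e / 2"] by auto
    have "dist (c m) (c N) < e / 2" if "m \<ge> N" for m
    proof -
      have "r m \<ge> \<rho>" using decseq_ge[OF dec \<rho>] .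
      moreover have "dist (c m) (c N) \<le> r N - r m" using dist[of N "m - N"] that by simp
      ultimately show ?thesis
        using N[OF order_refl] abs_ge_self[of "r N - \<rho>"] unfolding dist_real_def by linarith
    qed
    thus "\<exists>M. \<forall>m\<ge>M. \<forall>n\<ge>M. dist (c m) (c n) < e"
      by (intro exI[of _ N] allI impI) (rule dist_triangle_half_l[of _ "c N"], auto)
  qed
  then obtain x where x: "c \<longlonglongrightarrow> x" using Cauchy_convergent convergent_def by blast
  have "dist x (c n) \<le> r n - \<rho>" for n
  proof (rule LIMSEQ_le)
    show "(\<lambda>k. dist (c (k + n)) (c n)) \<longlonglongrightarrow> dist x (c n)"
      by (intro tendsto_dist LIMSEQ_ignore_initial_segment[OF x] tendsto_const)
    show "(\<lambda>k. r n - r (k + n)) \<longlonglongrightarrow> r n - \<rho>"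
      by (intro tendsto_diff LIMSEQ_ignore_initial_segment[OF \<rho>] tendsto_const)
    show "\<exists>N. \<forall>k\<ge>N. dist (c (k + n)) (c n) \<le> r n - r (k + n)"
      using dist[of n] by (auto simp: add.commute)
  qed
  thus thesis using that \<rho>0 \<rho> unfolding c_def r_def by blast
qed

text \<open>
  Bob may keep his radii bounded away from \<open>0\<close>. Then the intersection of his balls contains a
  ball, and a play of Bob inside that ball with radii tending to \<open>0\<close> produces a point of \<open>W\<close> in it.
\<close>

lemma winning_strategyI:
  fixes s :: "'a::complete_space strategy"
  assumes \<beta>: "0 < \<beta>" "\<beta> < 1"
    and alice: "\<And>B n. bob_legal_upto UNIV \<beta> s B n \<Longrightarrow> alice_legal H \<beta> (B n) (alice_reply s B n)"
    and bob: "\<And>B n. bob_legal_upto UNIV \<beta> s B n \<Longrightarrow>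
      \<exists>B'. bob_next UNIV \<beta> (B n) (alice_reply s B n) B' \<and> snd B' = \<beta> * snd (B n)"
    and win: "\<And>B x. (\<And>n. bob_legal_upto UNIV \<beta> s B n) \<Longrightarrow> (\<lambda>n. snd (B n)) \<longlonglongrightarrow> 0 \<Longrightarrow>
      (\<And>n. dist x (fst (B n)) \<le> snd (B n)) \<Longrightarrow> x \<in> W"
  shows "winning_strategy H \<beta> UNIV W s"
proof -
  have "W \<inter> UNIV \<inter> (\<Inter>n. ball_of (B n)) \<noteq> {}" if legal: "\<And>n. bob_legal_upto UNIV \<beta> s B n" for B
  proof -
    obtain x \<rho> where x: "\<rho> \<ge> 0" "(\<lambda>n. snd (B n)) \<longlonglongrightarrow> \<rho>" "\<And>n. dist x (fst (B n)) \<le> snd (B n) - \<rho>"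
      by (rule play_limit[OF legal], rule that)
    have "\<exists>y\<in>W. dist y x \<le> \<rho>"
    proof (cases "\<rho> = 0")
      case True
      have lim: "(\<lambda>n. snd (B n)) \<longlonglongrightarrow> 0" using x(2) unfolding True .
      have near: "dist x (fst (B n)) \<le> snd (B n)" for n using x(3)[of n] True by simp
      have "x \<in> W" by (rule win[OF legal lim near])
      thus ?thesis using x(1) by (intro bexI[of _ x]) simp_all
    next
      case False
      \<comment> \<open>The assumptions on \<open>s\<close> cover every legal play, so the limiting
        ball may open a fresh game.\<close>
      have "bob_first UNIV (x, \<rho>)" using False x(1) by (simp add: bob_first_def)
      from play_exists[OF bob this] obtain B' where
        B': "B' 0 = (x, \<rho>)" "\<And>n. bob_legal_upto UNIV \<beta> s B' n" "\<And>n. snd (B' (Suc n)) = \<beta> * snd (B' n)"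
        by blast
      have "snd (B' n) = \<beta> ^ n * \<rho>" for n by (induction n) (simp_all add: B')
      hence lim: "(\<lambda>n. snd (B' n)) \<longlonglongrightarrow> 0"
        using tendsto_mult_right[OF LIMSEQ_realpow_zero[of \<beta>], of \<rho>] \<beta> by simp
      obtain y \<rho>' where y: "\<rho>' \<ge> 0" "\<And>n. dist y (fst (B' n)) \<le> snd (B' n) - \<rho>'"
        by (rule play_limit[OF B'(2)], rule that)
      have near: "dist y (fst (B' n)) \<le> snd (B' n)" for n using y(1) y(2)[of n] by simp
      have "y \<in> W" by (rule win[OF B'(2) lim near])
      thus ?thesis using near[of 0] B'(1) by (intro bexI[of _ y]) simp_all
    qed
    then obtain y where y: "y \<in> W" "dist y x \<le> \<rho>" by blast
    have "dist (fst (B n)) y \<le> snd (B n)" for n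
      using x(3)[of n] y(2) dist_triangle[of y "fst (B n)" x] by (simp add: dist_commute)
    thus ?thesis using y(1) by (auto simp: ball_of_def)
  qed
  thus ?thesis unfolding winning_strategy_def using alice bob by blast
qed

section \<open>Coordinate subspaces and Bob's legal moves\<close>

lemma infdist_coord_subspace_le:
  fixes c x :: "'k::number_field KS"
  assumes "\<And>v. v \<in> T \<Longrightarrow> cmod (coord c v - coord x v) \<le> M" "0 \<le> M"
  shows "infdist c (coord_subspace x T) \<le> M"
proof -
  \<comment> \<open>Overwriting the coordinates in \<open>T\<close> by those of \<open>x\<close>
    gives a nearest point of the subspace.\<close>
  define y where "y = KS (\<lambda>v. if v \<in> T then coord x v else coord c v)"
  have y: "coord y v = (if v \<in> T then coord x v else coord c v)" for v
    unfolding y_def using coord[of x] coord[of c] by (subst KS_inverse) auto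
  have "y \<in> coord_subspace x T" by (simp add: coord_subspace_def y)
  moreover have "dist c y \<le> M"
    unfolding dist_norm norm_KS_le_iff using assms by (simp add: y)
  ultimately show ?thesis using infdist_le2 by blast
qed

lemma infdist_coord_subspace_ge:
  fixes c x :: "'k::number_field KS"
  assumes "v \<in> T"
  shows "cmod (coord c v - coord x v) \<le> infdist c (coord_subspace x T)"
proof -
  have ne: "coord_subspace x T \<noteq> {}" by (auto simp: coord_subspace_def)
  have "cmod (coord c v - coord x v) \<le> dist c y" if "y \<in> coord_subspace x T" for y
    using that assms norm_coord_le[of "c - y" v] by (simp add: coord_subspace_def dist_norm)
  thus ?thesis unfolding infdist_notempty[OF ne] by (intro cINF_greatest[OF ne])
qed

text \<open>The weight condition of \<open>H_K\<close>, cleared of fractions and with local degrees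
  as weights.\<close>

definition heavy :: "'k::number_field place set \<Rightarrow> bool" where
  "heavy T \<longleftrightarrow> T \<subseteq> arch_places \<and> field_degree TYPE('k) < 2 * (\<Sum>v\<in>T. card v)"

lemma coord_subspace_in_H_K:
  fixes T :: "'k::number_field place set"
  assumes "heavy T"
  shows "coord_subspace (iota r) T \<in> H_K"
proof -
  have "field_degree TYPE('k) < 2 * (card (real_part_of T) + 2 * card (complex_part_of T))"
    using assms sum_card_places[of T] by (simp add: heavy_def)
  hence "real (field_degree TYPE('k)) < real (2 * (card (real_part_of T) + 2 * card (complex_part_of T)))"
    by (simp only: of_nat_less_iff)
  thus ?thesis using assms unfolding H_K_def heavy_def by force
qed

lemma heavy_arch_places: "heavy (arch_places :: 'k::number_field place set)"
  using field_degree_pos[where 'k = 'k] by (simp add: heavy_def sum_card_arch_places)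

text \<open>Bob can shift his centre by \<open>(1 - \<beta>) \<rho>\<close> in two opposite
  directions along the diagonal. At a place of \<open>T\<close> the two results differ by twice this
  amount, so one of them is at least \<open>(1 - \<beta>) \<rho>\<close> away from \<open>x\<close>;
  this exceeds \<open>2 \<beta> \<rho>\<close> because \<open>\<beta> < 1 / 3\<close>.\<close>

lemma bob_next_exists:
  fixes c :: "'k::number_field KS"
  assumes "heavy T" "0 < \<beta>" "\<beta> < 1 / 3" "\<rho> > 0"
  shows "\<exists>B'. bob_next UNIV \<beta> (c, \<rho>) (coord_subspace x T, \<beta> * \<rho>) B' \<and> snd B' = \<beta> * snd (c, \<rho>)"
proof -
  have "T \<noteq> {}" using assms(1) by (auto simp: heavy_def)
  then obtain v where v: "v \<in> T" by blast
  hence S: "v \<in> arch_places" using assms(1) by (auto simp: heavy_def)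
  define t where "t = (1 - \<beta>) * \<rho>"
  have t: "t > 0" "2 * (\<beta> * \<rho>) < t" using assms by (auto simp: t_def algebra_simps)
  let ?z = "coord c v - coord x v"
  have "cmod (?z + of_real t - (?z - of_real t)) \<le> cmod (?z + of_real t) + cmod (?z - of_real t)"
    by (rule norm_triangle_ineq4)
  hence "2 * t \<le> cmod (?z + of_real t) + cmod (?z - of_real t)"
    using t by (simp flip: of_real_add)
  hence "t \<le> cmod (?z + of_real t) \<or> t \<le> cmod (?z + of_real (- t))"
    by (simp, linarith)
  then obtain s where s: "\<bar>s\<bar> = t" "t \<le> cmod (?z + of_real s)" using t by (metis abs_of_pos abs_minus_cancel)
  \<comment> \<open>\<open>iota 1\<close> has coordinate \<open>1\<close> at every Archimedean place
    and spans the diagonal.\<close>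
  define c' where "c' = c + s *\<^sub>R iota 1"
  have "norm (iota (1 :: 'k)) \<le> 1" unfolding norm_KS_le_iff by (simp add: coord_iota_1)
  hence "dist c' c \<le> t" using t(1) s(1) by (simp add: c'_def dist_norm mult_left_le)
  moreover have eq: "coord c' v - coord x v = ?z + of_real s"
    by (simp add: c'_def coord_iota_1[OF S] scaleR_conv_of_real)
  have "infdist c' (coord_subspace x T) \<ge> t"
    using infdist_coord_subspace_ge[OF v, of c' x] s(2) unfolding eq by linarith
  ultimately have "dist c' c \<le> \<rho> - \<beta> * \<rho>" "\<beta> * \<rho> + \<beta> * \<rho> < infdist c' (coord_subspace x T)"
    using t(2) by (simp_all add: t_def algebra_simps)
  hence "bob_next UNIV \<beta> (c, \<rho>) (coord_subspace x T, \<beta> * \<rho>) (c', \<beta> * \<rho>)"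
    using assms by (simp add: bob_next_def formal_le_def)
  thus ?thesis by auto
qed

section \<open>Alice's strategy and its analysis\<close>

definition dangerous :: "real \<Rightarrow> 'k::number_field KS \<Rightarrow> real \<Rightarrow> 'k \<Rightarrow> bool" where
  "dangerous \<epsilon> c \<rho> t \<longleftrightarrow> (\<exists>p\<in>ring_of_integers. \<exists>q\<in>ring_of_integers - {0}.
     t = - p / q \<and> point_covolume p q c \<rho> < \<epsilon>)"

text \<open>Two covolumes below \<open>\<epsilon>\<close> have product below
  \<open>\<epsilon>\<^sup>2\<close>, and \<open>4 ^ d\<close> times this is at most
  \<open>1\<close>; so the determinant of the two pairs vanishes.\<close>

lemma dangerous_unique:
  fixes c :: "'k::number_field KS"
  assumes "dangerous \<epsilon> c \<rho> t" "dangerous \<epsilon> c \<rho> t'" "\<rho> > 0" and \<epsilon>: "\<epsilon> \<le> 1 / 4 ^ field_degree TYPE('k)"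
  shows "t = t'"
proof -
  obtain p q p' q' where pq: "p \<in> ring_of_integers" "q \<in> ring_of_integers" "q \<noteq> 0"
      "p' \<in> ring_of_integers" "q' \<in> ring_of_integers" "q' \<noteq> 0" "t = - p / q" "t' = - p' / q'"
    and small: "point_covolume p q c \<rho> < \<epsilon>" "point_covolume p' q' c \<rho> < \<epsilon>"
    using assms(1,2) unfolding dangerous_def by blast
  have nonneg: "0 \<le> point_covolume p q c \<rho>" for p q
    unfolding point_covolume_def covolume_def using assms(3) by (intro prod_nonneg) auto
  have "4 ^ field_degree TYPE('k) * (point_covolume p q c \<rho> * point_covolume p' q' c \<rho>)
      < 4 ^ field_degree TYPE('k) * (\<epsilon> * \<epsilon>)"
    using small nonneg by (intro mult_strict_left_mono mult_strict_mono') auto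
  also have "\<dots> \<le> 4 ^ field_degree TYPE('k) * (1 / 4 ^ field_degree TYPE('k) * 1)"
  proof (intro mult_left_mono mult_mono)
    show "0 \<le> \<epsilon>" using small(1) nonneg[of p q] by linarith
    have "1 / 4 ^ field_degree TYPE('k) \<le> (1 :: real)" by simp
    thus "\<epsilon> \<le> 1" using \<epsilon> by linarith
  qed (use \<epsilon> in auto)
  also have "\<dots> = 1" by simp
  finally have "p * q' = p' * q" using pq assms(3) by (intro point_covolume_unique) auto
  thus ?thesis using pq(3,6) unfolding pq(7,8) by (simp add: frac_eq_eq)
qed

text \<open>The factor \<open>2\<close> allows for the limit point, unknown to Alice: it lies within
  \<open>\<rho>\<close> of \<open>c\<close>, so every place at which it is within
  \<open>\<rho>\<close> of \<open>t\<close> is included.\<close>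

definition near_places :: "'k::number_field KS \<Rightarrow> real \<Rightarrow> 'k \<Rightarrow> 'k place set" where
  "near_places c \<rho> t = {v \<in> arch_places. cmod (coord c v - coord (iota t) v) \<le> 2 * \<rho>}"

text \<open>If no \<open>t\<close> is dangerous, the choice is arbitrary. The second branch, the
  single point \<open>0\<close>, keeps the move legal whenever the places found are too
  light.\<close>

definition alice_target :: "real \<Rightarrow> 'k::number_field KS \<Rightarrow> real \<Rightarrow> 'k KS set" where
  "alice_target \<epsilon> c \<rho> = (let t = (SOME t. dangerous \<epsilon> c \<rho> t) in
     if heavy (near_places c \<rho> t) then coord_subspace (iota t) (near_places c \<rho> t)
     else coord_subspace (iota 0) arch_places)"

lemma alice_target_cases:
  obtains t T where "alice_target \<epsilon> c \<rho> = coord_subspace (iota t) T" "heavy T"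
  unfolding alice_target_def Let_def using heavy_arch_places by (metis (full_types))

lemma alice_target_dangerous:
  fixes c :: "'k::number_field KS"
  assumes "dangerous \<epsilon> c \<rho> t" "\<rho> > 0" "\<epsilon> \<le> 1 / 4 ^ field_degree TYPE('k)" "heavy (near_places c \<rho> t)"
  shows "alice_target \<epsilon> c \<rho> = coord_subspace (iota t) (near_places c \<rho> t)"
proof -
  have "(SOME t. dangerous \<epsilon> c \<rho> t) = t"
    using someI[of "dangerous \<epsilon> c \<rho>", OF assms(1)] dangerous_unique[OF _ assms(1-3)] by blast
  thus ?thesis using assms(4) by (simp add: alice_target_def)
qed

text \<open>
  The threshold depends on the first radius, so that at the beginning of the game no rational point
  has a covolume below it.
\<close>

definition alice_threshold :: "'k::number_field itself \<Rightarrow> real \<Rightarrow> real" where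
  "alice_threshold K \<rho> = min (1 / 4 ^ field_degree K) (\<rho> ^ field_degree K)"

definition alice_strategy :: "real \<Rightarrow> 'k::number_field KS strategy" where
  "alice_strategy \<beta> l = (alice_target (alice_threshold TYPE('k) (snd (hd l))) (fst (last l)) (snd (last l)),
     \<beta> * snd (last l))"

lemma alice_reply_strategy:
  fixes B :: "nat \<Rightarrow> 'k::number_field KS formal_ball"
  shows "alice_reply (alice_strategy \<beta>) B n =
     (alice_target (alice_threshold TYPE('k) (snd (B 0))) (fst (B n)) (snd (B n)), \<beta> * snd (B n))"
proof -
  have "hd (map B [0..<Suc n]) = B 0" by (simp add: hd_map del: upt_Suc)
  moreover have "last (map B [0..<Suc n]) = B n" by simp
  ultimately show ?thesis by (simp only: alice_reply_def alice_strategy_def)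
qed

text \<open>Each rational point is followed along the play by means of
  \<open>covolume_lower_bound\<close> with threshold \<open>\<epsilon> / 4 ^ d\<close>. A covolume
  below it at \<open>x\<close> is below \<open>\<epsilon>\<close> at the centre, so Alice's move was
  aimed at this very point.\<close>

lemma alice_strategy_point_covolume:
  fixes B :: "nat \<Rightarrow> 'k::number_field KS formal_ball"
  assumes \<beta>: "0 < \<beta>" "\<beta> < 1" and legal: "\<And>n. bob_legal_upto UNIV \<beta> (alice_strategy \<beta>) B n"
    and x: "\<And>n. dist x (fst (B n)) \<le> snd (B n)"
  obtains \<delta> where "\<delta> > 0" "\<And>p q n. p \<in> ring_of_integers \<Longrightarrow> q \<in> ring_of_integers \<Longrightarrow> q \<noteq> 0 \<Longrightarrow>
     \<delta> \<le> point_covolume p q x (snd (B n))"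
proof -
  define c where "c n = fst (B n)" for n
  define r where "r n = snd (B n)" for n
  define d where "d = field_degree TYPE('k)"
  define \<epsilon> where "\<epsilon> = alice_threshold TYPE('k) (r 0)"
  have nxt: "bob_next UNIV \<beta> (B n) (alice_target \<epsilon> (c n) (r n), \<beta> * r n) (B (Suc n))" for n
    using legal[of "Suc n"] by (simp add: bob_legal_upto_Suc alice_reply_strategy c_def r_def \<epsilon>_def)
  have r0: "0 < r 0" using legal[of 0] by (simp add: bob_legal_upto_def bob_first_def r_def)
  have r_Suc: "0 < r (Suc n)" "r (Suc n) \<le> r n" "\<beta> * r n \<le> r (Suc n)" for n
    using nxt[of n] by (auto simp: bob_next_def r_def)
  have r: "0 < r n" for n using r0 r_Suc(1) by (cases n) auto
  have near: "cmod (coord x v - coord (c n) v) \<le> r n" for n v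
    using x[of n] norm_coord_le[of "x - c n" v] by (simp add: dist_norm c_def r_def)
  have \<epsilon>: "0 < \<epsilon>" "\<epsilon> \<le> 1 / 4 ^ d" "\<epsilon> \<le> r 0 ^ d"
    using r0 by (simp_all add: \<epsilon>_def alice_threshold_def d_def)
  define \<delta> where "\<delta> = (\<beta>\<^sup>2 * (\<beta>\<^sup>2 / 3) ^ card (arch_places :: 'k place set)) ^ d * (\<epsilon> / 4 ^ d)"
  have "\<delta> \<le> point_covolume p q x (r m)"
    if p: "p \<in> ring_of_integers" and q: "q \<in> ring_of_integers" "q \<noteq> 0" for p q m
  proof -
    define t where "t = - p / q"
    define A where "A v = cmod (coord (iota q * x + iota p) v)" for v
    define Q where "Q v = cmod (coord (iota q) v)" for v
    have Q: "Q v > 0" if "v \<in> arch_places" for v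
      using coord_iota_nonzero[OF that q(2)] by (simp add: Q_def)
    \<comment> \<open>\<open>t\<close> is the zero of \<open>q x + p\<close>, so
      \<open>A v / Q v\<close> measures the distance from \<open>x\<close> to
      \<open>t\<close>.\<close>
    have A: "A v = Q v * cmod (coord x v - coord (iota t) v)" for v
    proof -
      have "p = - (q * t)" using q by (simp add: t_def)
      hence "iota q * x + iota p = iota q * (x - iota t)" by (simp add: iota_simps algebra_simps)
      thus ?thesis by (simp add: A_def Q_def norm_mult)
    qed
    have eq: "point_covolume p q x = covolume arch_places card A Q"
      by (simp add: point_covolume_def A_def[abs_def] Q_def[abs_def])
    have "(\<beta>\<^sup>2 * (\<beta>\<^sup>2 / 3) ^ card (arch_places :: 'k place set)) ^
        (\<Sum>v\<in>(arch_places :: 'k place set). card v) * (\<epsilon> / 4 ^ d) \<le> covolume arch_places card A Q (r m)"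
    proof (rule covolume_lower_bound[where r = r, OF \<beta> r r_Suc(2,3)])
      have "\<epsilon> / 4 ^ d \<le> \<epsilon> / 1" using \<epsilon> by (intro divide_left_mono) auto
      also have "\<dots> \<le> r 0 ^ d" using \<epsilon> by simp
      also have "\<dots> \<le> point_covolume p q x (r 0)"
        unfolding d_def by (rule point_covolume_ge[OF q r])
      finally show "\<epsilon> / 4 ^ d \<le> covolume arch_places card A Q (r 0)" by (simp add: eq)
    next
      fix n
      assume small: "covolume arch_places card A Q (r n) < \<epsilon> / 4 ^ d"
        and wt: "(\<Sum>v\<in>(arch_places :: 'k place set). card v) <
          2 * (\<Sum>v | v \<in> arch_places \<and> A v \<le> r n * Q v. card v)"
      have "dist (c n) x \<le> r n" using x[of n] by (simp add: c_def r_def dist_commute)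
      hence "point_covolume p q (c n) (r n) \<le> 4 ^ d * covolume arch_places card A Q (r n)"
        unfolding d_def eq[symmetric] by (rule point_covolume_compare[OF _ r])
      also have "\<dots> < \<epsilon>" using small by (simp add: field_simps)
      finally have dang: "dangerous \<epsilon> (c n) (r n) t"
        unfolding dangerous_def t_def using p q by blast
      have close: "cmod (coord x v - coord (iota t) v) \<le> r n"
        if "v \<in> arch_places" "A v \<le> r n * Q v" for v
        using that Q[OF that(1)] by (simp add: A mult.commute)
      have "(\<Sum>v | v \<in> arch_places \<and> A v \<le> r n * Q v. card v) \<le> (\<Sum>v\<in>near_places (c n) (r n) t. card v)"
      proof (rule sum_mono2)
        show "{v. v \<in> arch_places \<and> A v \<le> r n * Q v} \<subseteq> near_places (c n) (r n) t"
        proof safe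
          fix v assume v: "v \<in> arch_places" "A v \<le> r n * Q v"
          have "cmod (coord (c n) v - coord (iota t) v) \<le>
              cmod (coord x v - coord (c n) v) + cmod (coord x v - coord (iota t) v)"
            using norm_triangle_ineq4[of "coord x v - coord (iota t) v" "coord x v - coord (c n) v"] by simp
          thus "v \<in> near_places (c n) (r n) t"
            using close[OF v] near[of v n] v(1) by (simp add: near_places_def)
        qed
      qed (auto simp: near_places_def)
      hence "heavy (near_places (c n) (r n) t)"
        using wt by (auto simp: heavy_def near_places_def sum_card_arch_places)
      hence target: "alice_target \<epsilon> (c n) (r n) = coord_subspace (iota t) (near_places (c n) (r n) t)"
        using \<epsilon>(2) r by (intro alice_target_dangerous[OF dang]) (auto simp: d_def)
      \<comment> \<open>Bob's next centre escapes from the subspace in at least one coordinate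
        \<open>v\<close> of \<open>T\<close>. As \<open>x\<close> is within \<open>r (Suc n)\<close>
        of that centre, it is more than \<open>\<beta> * r n\<close> away from \<open>t\<close> at
        \<open>v\<close>; the upper bound \<open>3 * r n\<close> is \<open>2 * r n\<close> for a
        near place plus \<open>r n\<close> from the centre to \<open>x\<close>.\<close>
      have "\<exists>v\<in>near_places (c n) (r n) t. \<beta> * r n + r (Suc n) < cmod (coord (c (Suc n)) v - coord (iota t) v)"
      proof (rule ccontr)
        assume "\<not> ?thesis"
        hence "infdist (c (Suc n)) (coord_subspace (iota t) (near_places (c n) (r n) t)) \<le> \<beta> * r n + r (Suc n)"
          using \<beta> less_imp_le[OF r] by (intro infdist_coord_subspace_le) (auto simp: not_less)
        thus False using nxt[of n] unfolding bob_next_def target by (simp add: c_def r_def)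
      qed
      then obtain v where v: "v \<in> arch_places" "cmod (coord (c n) v - coord (iota t) v) \<le> 2 * r n"
          "\<beta> * r n + r (Suc n) < cmod (coord (c (Suc n)) v - coord (iota t) v)"
        by (auto simp: near_places_def)
      have "cmod (coord (c (Suc n)) v - coord (iota t) v) \<le>
          cmod (coord x v - coord (c (Suc n)) v) + cmod (coord x v - coord (iota t) v)"
        using norm_triangle_ineq4[of "coord x v - coord (iota t) v" "coord x v - coord (c (Suc n)) v"] by simp
      hence "\<beta> * r n < cmod (coord x v - coord (iota t) v)" using v(3) near[of v "Suc n"] by simp
      moreover have "cmod (coord x v - coord (iota t) v) \<le> 3 * r n"
        using norm_triangle_ineq[of "coord x v - coord (c n) v" "coord (c n) v - coord (iota t) v"]
          v(2) near[of v n] by simp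
      ultimately show "\<exists>v\<in>arch_places. \<beta> * r n * Q v < A v \<and> A v \<le> 3 * r n * Q v"
        using v(1) Q[OF v(1)] by (intro bexI[of _ v]) (auto simp: A mult.commute)
    qed (use \<epsilon> Q in \<open>auto simp: A_def\<close>)
    thus ?thesis by (simp add: eq \<delta>_def sum_card_arch_places d_def)
  qed
  moreover have "\<delta> > 0" using \<beta> \<epsilon> by (simp add: \<delta>_def)
  ultimately show thesis using that unfolding r_def by blast
qed

theorem theorem1p3:
  shows "absolute_winning H_K (BA :: 'k::number_field KS set)"
proof -
  \<comment> \<open>The bound \<open>1 / 3\<close> guarantees Bob a legal move against every heavy
    target.\<close>
  have "winning_strategy H_K \<beta> UNIV (BA :: 'k KS set) (alice_strategy \<beta>)" if \<beta>: "0 < \<beta>" "\<beta> < 1 / 3" for \<beta>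
  proof (rule winning_strategyI)
    fix B :: "nat \<Rightarrow> 'k KS formal_ball" and n
    assume legal: "bob_legal_upto UNIV \<beta> (alice_strategy \<beta>) B n"
    have pos: "snd (B n) > 0"
      using legal by (cases n) (auto simp: bob_legal_upto_def bob_first_def bob_next_def)
    obtain t T where T: "alice_target (alice_threshold TYPE('k) (snd (B 0))) (fst (B n)) (snd (B n)) =
        coord_subspace (iota t) T" "heavy T"
      using alice_target_cases by blast
    show "alice_legal H_K \<beta> (B n) (alice_reply (alice_strategy \<beta>) B n)"
      using pos \<beta> coord_subspace_in_H_K[OF T(2)] by (simp add: alice_legal_def alice_reply_strategy T)
    show "\<exists>B'. bob_next UNIV \<beta> (B n) (alice_reply (alice_strategy \<beta>) B n) B' \<and> snd B' = \<beta> * snd (B n)"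
      using bob_next_exists[OF T(2) \<beta> pos, of "fst (B n)" "iota t"] by (simp add: alice_reply_strategy T)
  next
    fix B :: "nat \<Rightarrow> 'k KS formal_ball" and x
    assume legal: "\<And>n. bob_legal_upto UNIV \<beta> (alice_strategy \<beta>) B n"
      and lim: "(\<lambda>n. snd (B n)) \<longlonglongrightarrow> 0" and x: "\<And>n. dist x (fst (B n)) \<le> snd (B n)"
    have \<beta>1: "\<beta> < 1" using \<beta> by simp
    obtain \<delta> where \<delta>: "\<delta> > 0" "\<And>p q n. p \<in> ring_of_integers \<Longrightarrow> q \<in> ring_of_integers \<Longrightarrow> q \<noteq> 0 \<Longrightarrow>
        \<delta> \<le> point_covolume p q x (snd (B n))"
      using alice_strategy_point_covolume[OF \<beta>(1) \<beta>1 legal x] by blast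
    have r: "0 < snd (B n)" "\<beta> * snd (B n) \<le> snd (B (Suc n))" for n
      using legal[of "Suc n"] legal[of n]
      by (cases n; auto simp: bob_legal_upto_Suc bob_legal_upto_def bob_first_def bob_next_def)+
    show "x \<in> BA"
      by (rule BA_if_point_covolume_bounded_below[where r = "\<lambda>n. snd (B n)", OF \<beta>(1) r lim \<delta> \<beta>1])
  qed (use \<beta> in auto)
  thus ?thesis
    unfolding absolute_winning_on_def beta_absolute_winning_on_def by (intro exI[of _ "1 / 3"]) auto
qed

end
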